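(* Let $N,P\in\mathbb{N}$, let $\sigma=(\sigma_1,\dots,\sigma_P)\in\mathbb{R}^{N\times P}$ (with columns $\sigma_i\in\mathbb{R}^N$), and let $\mu$ be a nonnegative symmetric Radon measure on $\mathbb{R}^N\setminus\{0\}$ satisfying $\int_{|z|>0}\min\{|z|^2,1\}\,\mathrm{d}\mu(z)<\infty$. Let $\varphi:\mathbb{R}\to\mathbb{R}$ be nondecreasing and continuous, and let $f\in L^\infty(\mathbb{R}^N)$. Then there is at most one distributional solution $w$ of $$w-\mathfrak{L}^{\sigma,\mu}[\varphi(w)]=f\quad\text{on }\mathbb{R}^N$$ such that $w\in L^\infty(\mathbb{R}^N)$ and $w-f\in L^1(\mathbb{R}^N)$.
   Context: For $\psi\in C_c^\infty(\mathbb{R}^N)$ the operator is $\mathfrak{L}^{\sigma,\mu}[\psi]:=L^\sigma[\psi]+\mathcal{L}^\mu[\psi]$, where $L^\sigma[\psi](x):=\mathrm{tr}(\sigma\sigma^T D^2\psi(x))=\sum_{i=1}^P(\sigma_i\cdot D)^2\psi(x)$ and $\mathcal{L}^\mu[\psi](x):=\int_{\mathbb{R}^N\setminus\{0\}}\big(\psi(x+z)-\psi(x)-z\cdot D\psi(x)\mathbf{1}_{|z|\le 1}\big)\,\mathrm{d}\mu(z)$. A distributional solution is a function $w\in L^\infty(\mathbb{R}^N)$ such that $\int_{\mathbb{R}^N}\big(w\,\psi-\varphi(w)\,\mathfrak{L}^{\sigma,\mu}[\psi]\big)\,\mathrm{d}x=\int_{\mathbb{R}^N}f\,\psi\,\mathrm{d}x$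 for all $\psi\in C_c^\infty(\mathbb{R}^N)$. *)

theory Defs
  imports "HOL-Analysis.Analysis"
begin

definition dirderiv :: "'a::euclidean_space \<Rightarrow> ('a \<Rightarrow> real) \<Rightarrow> 'a \<Rightarrow> real" where
  "dirderiv v g x = frechet_derivative g (at x) v"

definition grad :: "('a::euclidean_space \<Rightarrow> real) \<Rightarrow> 'a \<Rightarrow> 'a" where
  "grad g x = (\<Sum>b\<in>Basis. dirderiv b g x *\<^sub>R b)"

text \<open>C-infinity: g is differentiable everywhere, and so are all its iterated
  directional derivatives (greatest class closed under taking directional derivatives).\<close>
definition smooth :: "('a::euclidean_space \<Rightarrow> real) \<Rightarrow> bool" where
  "smooth g \<longleftrightarrow> (\<exists>F. g \<in> F \<and>
      (\<forall>h\<in>F. (\<forall>x. h differentiable (at x)) \<and> (\<forall>v. dirderiv v h \<in> F)))"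

definition test_function :: "('a::euclidean_space \<Rightarrow> real) \<Rightarrow> bool" where
  "test_function \<psi> \<longleftrightarrow> smooth \<psi> \<and> compact (closure {x. \<psi> x \<noteq> 0})"

definition local_op :: "nat \<Rightarrow> (nat \<Rightarrow> 'a::euclidean_space) \<Rightarrow> ('a \<Rightarrow> real) \<Rightarrow> 'a \<Rightarrow> real" where
  "local_op P \<sigma> \<psi> x = (\<Sum>i<P. dirderiv (\<sigma> i) (dirderiv (\<sigma> i) \<psi>) x)"

definition nonlocal_op :: "'a::euclidean_space measure \<Rightarrow> ('a \<Rightarrow> real) \<Rightarrow> 'a \<Rightarrow> real" where
  "nonlocal_op \<mu> \<psi> x = (LINT z:(UNIV - {0})|\<mu>.
      \<psi> (x + z) - \<psi> x - (if norm z \<le> 1 then z \<bullet> grad \<psi> x else 0))"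

definition levy_op :: "nat \<Rightarrow> (nat \<Rightarrow> 'a::euclidean_space) \<Rightarrow> 'a measure \<Rightarrow> ('a \<Rightarrow> real) \<Rightarrow> 'a \<Rightarrow> real" where
  "levy_op P \<sigma> \<mu> \<psi> x = local_op P \<sigma> \<psi> x + nonlocal_op \<mu> \<psi> x"

definition Linfty :: "('a::euclidean_space \<Rightarrow> real) \<Rightarrow> bool" where
  "Linfty w \<longleftrightarrow> w \<in> borel_measurable lborel \<and> (\<exists>C. AE x in lborel. \<bar>w x\<bar> \<le> C)"

text \<open>Levy measure: nonnegative symmetric Borel measure on R^N \ {0} (no mass at 0),
  with int min(|z|^2,1) d mu < infinity.\<close>
definition levy_measure :: "'a::euclidean_space measure \<Rightarrow> bool" where
  "levy_measure \<mu> \<longleftrightarrow> sets \<mu> = sets borel \<and> emeasure \<mu> {0} = 0 \<and>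
     (\<forall>A\<in>sets borel. emeasure \<mu> (uminus ` A) = emeasure \<mu> A) \<and>
     (\<integral>\<^sup>+ z. ennreal (min ((norm z)\<^sup>2) 1) \<partial>\<mu>) < \<infinity>"

definition distributional_solution ::
  "nat \<Rightarrow> (nat \<Rightarrow> 'a::euclidean_space) \<Rightarrow> 'a measure \<Rightarrow> (real \<Rightarrow> real) \<Rightarrow> ('a \<Rightarrow> real) \<Rightarrow> ('a \<Rightarrow> real) \<Rightarrow> bool" where
  "distributional_solution P \<sigma> \<mu> \<phi> f w \<longleftrightarrow> Linfty w \<and>
     (\<forall>\<psi>. test_function \<psi> \<longrightarrow>
        (LINT x|lborel. w x * \<psi> x - \<phi> (w x) * levy_op P \<sigma> \<mu> \<psi> x) = (LINT x|lborel. f x * \<psi> x))"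

end

theory Submission
  imports Defs
begin

text \<open>Idea. For two solutions put \<open>w = w1 - w2\<close> and \<open>\<Phi> = \<phi>(w1) - \<phi>(w2)\<close>, so that \<open>w = L \<Phi>\<close> weakly,
  \<open>\<Phi> w \<ge> 0\<close>, \<open>w\<close> is integrable, and \<open>\<Phi>\<close> vanishes at infinity in the sense that
  \<open>\<bar>\<Phi>\<bar> \<le> \<delta> + b\<close> with \<open>b\<close> integrable, for every \<open>\<delta> > 0\<close>. Mollify \<open>\<Phi>\<close> to \<open>v\<close> and \<open>w\<close> to \<open>u\<close>, so
  \<open>u = L v\<close>. The soft threshold \<open>g = (\<bar>v\<bar> - \<delta>)\<^sup>+ sgn v\<close> is integrable and a nondecreasing
  function of \<open>v\<close>, hence \<open>\<integral> g u \<le> 0\<close> because \<open>L\<close> is a positive combination (or limit) of second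
  differences \<open>v(x + z) + v(x - z) - 2 v(x)\<close>. Letting \<open>\<delta> \<rightarrow> 0\<close> and removing the mollification
  gives \<open>\<integral> \<Phi> w \<le> 0\<close>. Applied to \<open>\<Phi> + t \<psi>\<close> and \<open>w + t L \<psi>\<close> for a test function \<open>\<psi>\<close> and all
  real \<open>t\<close>, the same inequality forces \<open>\<integral> w \<psi> = 0\<close>.\<close>

section \<open>Smooth functions and test functions\<close>

text \<open>Two obstacles shape the argument. The equation is weak, so the operator may fall on test
  functions only, and \<open>L v\<close> is never formed. Mollifying means testing with translates
  of one kernel \<open>\<rho>\<close>; this makes \<open>u\<close> the correlation of
  \<open>\<Phi>\<close> with \<open>levy_op P \<sigma> \<mu> \<rho>\<close>, and Fubini then moves
  second differences between \<open>\<rho>\<close> and \<open>v\<close>. Moreover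
  \<open>\<Phi>\<close> is bounded but perhaps not integrable. Its majorant
  \<open>\<delta> + b\<close> comes from uniform continuity of \<open>\<phi>\<close> on the common
  range of the solutions: there \<open>\<bar>\<phi> s - \<phi> t\<bar> \<le> \<delta> + K * \<bar>s
  - t\<bar>\<close>, and the integrable \<open>w\<close> supplies \<open>b\<close>. The perturbation
  is there because the energy inequality together with \<open>\<Phi> w \<ge> 0\<close> gives only
  \<open>\<Phi> w = 0\<close>, which says nothing about \<open>w\<close> where \<open>\<phi>\<close>
  takes the same value at both solutions. The perturbed pair solves the same linear equation since
  \<open>L\<close> is symmetric.\<close>

lemma smooth_differentiable: "smooth g \<Longrightarrow> g differentiable (at x)"
  unfolding smooth_def by blast

lemma smooth_dirderiv: "smooth g \<Longrightarrow> smooth (dirderiv v g)"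
  unfolding smooth_def by blast

lemma smooth_continuous: "smooth g \<Longrightarrow> continuous_on A g"
  by (meson continuous_at_imp_continuous_on differentiable_imp_continuous_within smooth_differentiable)

lemma has_derivative_dirderiv:
  "g differentiable (at x) \<Longrightarrow> (g has_derivative (\<lambda>v. dirderiv v g x)) (at x)"
  unfolding dirderiv_def by (simp add: frechet_derivative_works[symmetric])

lemma dirderiv_eqI: "(g has_derivative g') (at x) \<Longrightarrow> dirderiv v g x = g' v"
  unfolding dirderiv_def by (metis frechet_derivative_at)

lemma dirderiv_shift:
  assumes "\<And>x. g differentiable (at x)"
  shows "dirderiv v (\<lambda>x. g (x + a)) = (\<lambda>x. dirderiv v g (x + a))"
proof
  fix x
  have "((\<lambda>x. g (x + a)) has_derivative (\<lambda>v. dirderiv v g (x + a))) (at x)"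
    by (rule has_derivative_compose[of "\<lambda>x. x + a" "\<lambda>v. v" x UNIV g, simplified])
      (auto intro!: derivative_eq_intros has_derivative_dirderiv assms)
  then show "dirderiv v (\<lambda>x. g (x + a)) x = dirderiv v g (x + a)"
    by (rule dirderiv_eqI)
qed

text \<open>Translating every member of a class closed under \<open>dirderiv\<close> gives such a
  class again, because \<open>dirderiv\<close> commutes with translations.\<close>

lemma smooth_shift:
  fixes a :: "'a::euclidean_space"
  assumes "smooth g"
  shows "smooth (\<lambda>x. g (x + a))"
proof -
  obtain F where F: "g \<in> F" "\<And>h x. h \<in> F \<Longrightarrow> h differentiable (at x)" "\<And>h v. h \<in> F \<Longrightarrow> dirderiv v h \<in> F"
    using assms unfolding smooth_def by blast
  have "(\<lambda>x. h (x + a)) differentiable (at x)" if "h \<in> F" for h x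
  proof -
    have "(\<lambda>x. x + a) differentiable at x" by simp
    then show ?thesis
      using differentiable_compose[of h "\<lambda>x. x + a" x UNIV] F(2)[OF that] by (simp add: differentiable_at_withinI)
  qed
  then show ?thesis
    unfolding smooth_def
    by (intro exI[of _ "(\<lambda>h x. h (x + a)) ` F"]) (use F in \<open>auto simp: dirderiv_shift\<close>)
qed

lemma dirderiv_expand:
  assumes "g differentiable (at x)"
  shows "dirderiv v g x = (\<Sum>b\<in>Basis. (v \<bullet> b) * dirderiv b g x)"
proof -
  have "linear (\<lambda>v. dirderiv v g x)"
    using has_derivative_dirderiv[OF assms] has_derivative_linear by blast
  then have "dirderiv (\<Sum>b\<in>Basis. (v \<bullet> b) *\<^sub>R b) g x = (\<Sum>b\<in>Basis. (v \<bullet> b) *\<^sub>R dirderiv b g x)"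
    by (simp add: linear_sum[of "\<lambda>v. dirderiv v g x"] linear_cmul[of "\<lambda>v. dirderiv v g x"])
  then show ?thesis by (simp add: euclidean_representation)
qed

lemma inner_grad:
  assumes "g differentiable (at x)"
  shows "v \<bullet> grad g x = dirderiv v g x"
  unfolding grad_def dirderiv_expand[OF assms, of v] by (simp add: inner_sum_right mult.commute)

text \<open>Reduces all directions to finitely many mixed derivatives along \<open>Basis\<close>, so
  that a bound quadratic in \<open>v\<close> follows from bounds on finitely many test
  functions.\<close>

lemma dirderiv2_expand:
  assumes "smooth g"
  shows "dirderiv v (dirderiv v g) x
    = (\<Sum>b\<in>Basis. \<Sum>c\<in>Basis. (v \<bullet> b) * (v \<bullet> c) * dirderiv c (dirderiv b g) x)"
proof -
  have "dirderiv v g = (\<lambda>x. \<Sum>b\<in>Basis. (v \<bullet> b) * dirderiv b g x)"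
    using dirderiv_expand[OF smooth_differentiable[OF assms]] by blast
  moreover have D: "((\<lambda>x. \<Sum>b\<in>Basis. (v \<bullet> b) * dirderiv b g x) has_derivative
      (\<lambda>u. \<Sum>b\<in>Basis. (v \<bullet> b) * dirderiv u (dirderiv b g) x)) (at x)"
    by (intro has_derivative_sum has_derivative_mult_right has_derivative_dirderiv
        smooth_differentiable smooth_dirderiv assms)
  ultimately have "dirderiv v (dirderiv v g) x = (\<Sum>b\<in>Basis. (v \<bullet> b) * dirderiv v (dirderiv b g) x)"
    using dirderiv_eqI[OF D, of v] by simp
  also have "\<dots> = (\<Sum>b\<in>Basis. \<Sum>c\<in>Basis. (v \<bullet> b) * (v \<bullet> c) * dirderiv c (dirderiv b g) x)"
    by (subst dirderiv_expand[of _ _ v])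
      (auto simp: smooth_differentiable smooth_dirderiv assms sum_distrib_left mult.assoc)
  finally show ?thesis .
qed

lemma dirderiv_zero_outside:
  assumes "\<And>x. R < norm x \<Longrightarrow> g x = 0" "R < norm x"
  shows "dirderiv v g x = 0"
proof -
  have "open {x::'a. R < norm x}"
    by (intro open_Collect_less continuous_intros)
  then have "(g has_derivative (\<lambda>_. 0)) (at x)"
    by (rule has_derivative_transform_within_open[of "\<lambda>_. 0" _ x UNIV "{x. R < norm x}", rotated])
      (use assms in auto)
  then show ?thesis by (rule dirderiv_eqI)
qed

section \<open>Functions vanishing outside a ball, and basic properties of test functions\<close>

lemma bounded_if_zero_outside:
  fixes g :: "'a::euclidean_space \<Rightarrow> real"
  assumes "continuous_on UNIV g" "\<And>x. R < norm x \<Longrightarrow> g x = 0"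
  shows "\<exists>M\<ge>0. \<forall>x. \<bar>g x\<bar> \<le> M"
proof -
  have "bounded (g ` cball 0 R)"
    by (intro compact_imp_bounded compact_continuous_image continuous_on_subset[OF assms(1)]) auto
  then obtain M where M: "\<forall>y\<in>g ` cball 0 R. norm y \<le> M"
    unfolding bounded_iff by blast
  then have "\<bar>g x\<bar> \<le> max M 0" for x
    by (cases "x \<in> cball 0 R") (use assms(2)[of x] in \<open>force simp: max_def\<close>)+
  then show ?thesis by (intro exI[of _ "max M 0"]) auto
qed

lemma integrable_if_zero_outside:
  fixes g :: "'a::euclidean_space \<Rightarrow> real"
  assumes "continuous_on UNIV g" "\<And>x. R < norm x \<Longrightarrow> g x = 0"
  shows "integrable lborel g"
proof -
  have "integrable lborel (\<lambda>x. indicator (cball 0 R) x *\<^sub>R g x)"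
    by (intro borel_integrable_compact continuous_on_subset[OF assms(1)]) auto
  moreover have "(\<lambda>x. indicator (cball 0 R) x *\<^sub>R g x) = g"
    by (rule ext) (use assms(2) in \<open>auto simp: indicator_def not_le\<close>)
  ultimately show ?thesis by simp
qed

lemma test_function_zero_outside:
  assumes "test_function \<psi>"
  obtains R where "R > 0" "\<And>x. R < norm x \<Longrightarrow> \<psi> x = 0"
proof -
  have "bounded {x. \<psi> x \<noteq> 0}"
    using assms unfolding test_function_def by (meson bounded_closure compact_imp_bounded bounded_subset closure_subset)
  then obtain R where R: "R > 0" "\<And>x. \<psi> x \<noteq> 0 \<Longrightarrow> norm x \<le> R"
    unfolding bounded_pos by auto
  with that[of R] show thesis by (meson not_le)
qed

text \<open>In Euclidean space the closure of a bounded set is compact, so compact support amounts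
  to vanishing outside some ball. Supports are handled in this form below.\<close>

lemma test_function_iff:
  "test_function \<psi> \<longleftrightarrow> smooth \<psi> \<and> (\<exists>R. \<forall>x. R < norm x \<longrightarrow> \<psi> x = 0)"
proof
  assume "smooth \<psi> \<and> (\<exists>R. \<forall>x. R < norm x \<longrightarrow> \<psi> x = 0)"
  then obtain R where "smooth \<psi>" and R: "\<And>x. R < norm x \<Longrightarrow> \<psi> x = 0" by blast
  moreover have "{x. \<psi> x \<noteq> 0} \<subseteq> cball 0 R"
    using R by (auto simp: not_less[symmetric])
  ultimately show "test_function \<psi>"
    unfolding test_function_def using bounded_subset[OF bounded_cball] by (auto simp: compact_closure)
next
  assume "test_function \<psi>"
  then show "smooth \<psi> \<and> (\<exists>R. \<forall>x. R < norm x \<longrightarrow> \<psi> x = 0)"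
    using test_function_zero_outside[of \<psi>] unfolding test_function_def by metis
qed

lemma test_function_shift:
  assumes "test_function \<psi>"
  shows "test_function (\<lambda>x. \<psi> (x + a))"
proof -
  obtain R where R: "\<And>x. R < norm x \<Longrightarrow> \<psi> x = 0"
    using test_function_zero_outside[OF assms] by blast
  have "\<psi> (x + a) = 0" if "R + norm a < norm x" for x
    using that norm_triangle_ineq4[of "x + a" a] by (intro R) simp
  then show ?thesis
    using assms smooth_shift[of \<psi> a] unfolding test_function_iff by blast
qed

lemma test_function_smooth: "test_function \<psi> \<Longrightarrow> smooth \<psi>"
  by (simp add: test_function_def)

lemma test_function_continuous: "test_function \<psi> \<Longrightarrow> continuous_on A \<psi>"
  by (intro smooth_continuous test_function_smooth)

lemma test_function_measurable: "test_function \<psi> \<Longrightarrow> \<psi> \<in> borel_measurable borel"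
  by (intro borel_measurable_continuous_onI test_function_continuous)

lemma test_function_bounded:
  assumes "test_function \<psi>"
  shows "\<exists>M\<ge>0. \<forall>x. \<bar>\<psi> x\<bar> \<le> M"
proof -
  obtain R where "\<And>x. R < norm x \<Longrightarrow> \<psi> x = 0"
    using test_function_zero_outside[OF assms] by blast
  then show ?thesis by (rule bounded_if_zero_outside[OF test_function_continuous[OF assms]])
qed

lemma test_function_integrable:
  assumes "test_function \<psi>"
  shows "integrable lborel \<psi>"
proof -
  obtain R where "\<And>x. R < norm x \<Longrightarrow> \<psi> x = 0"
    using test_function_zero_outside[OF assms] by blast
  then show ?thesis by (rule integrable_if_zero_outside[OF test_function_continuous[OF assms]])
qed

lemma test_function_dirderiv:
  assumes "test_function \<psi>"
  shows "test_function (dirderiv v \<psi>)"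
proof -
  obtain R where R: "\<And>x. R < norm x \<Longrightarrow> \<psi> x = 0"
    using test_function_zero_outside[OF assms] by blast
  have "\<forall>x. R < norm x \<longrightarrow> dirderiv v \<psi> x = 0"
    using dirderiv_zero_outside[where g=\<psi> and R=R and v=v] R by simp
  with smooth_dirderiv[OF test_function_smooth[OF assms]] show ?thesis
    unfolding test_function_iff by auto
qed

lemma dirderiv2_bounded:
  fixes \<psi> :: "'a::euclidean_space \<Rightarrow> real"
  assumes "test_function \<psi>"
  shows "\<exists>M\<ge>0. \<forall>v x. \<bar>dirderiv v (dirderiv v \<psi>) x\<bar> \<le> M * (norm v)\<^sup>2"
proof -
  have "\<forall>b c. \<exists>M\<ge>0. \<forall>x. \<bar>dirderiv c (dirderiv b \<psi>) x\<bar> \<le> M"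
    using assms test_function_bounded test_function_dirderiv by blast
  then obtain M where M: "\<And>b c. M b c \<ge> 0" "\<And>b c x. \<bar>dirderiv c (dirderiv b \<psi>) x\<bar> \<le> M b c"
    by metis
  have "\<bar>dirderiv v (dirderiv v \<psi>) x\<bar> \<le> (\<Sum>b\<in>Basis. \<Sum>c\<in>Basis. M b c) * (norm v)\<^sup>2" for v x
  proof -
    have "\<bar>dirderiv v (dirderiv v \<psi>) x\<bar>
        \<le> (\<Sum>b\<in>Basis. \<Sum>c\<in>Basis. \<bar>(v \<bullet> b) * (v \<bullet> c) * dirderiv c (dirderiv b \<psi>) x\<bar>)"
      unfolding dirderiv2_expand[OF test_function_smooth[OF assms]]
      by (rule order_trans[OF sum_abs sum_mono[OF sum_abs]])
    also have "\<dots> \<le> (\<Sum>b\<in>Basis. \<Sum>c\<in>Basis. norm v * norm v * M b c)"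
      unfolding abs_mult by (intro sum_mono mult_mono M Basis_le_norm) auto
    finally show ?thesis
      by (simp add: sum_distrib_left sum_distrib_right power2_eq_square mult.commute)
  qed
  then show ?thesis
    using M(1) by (intro exI[of _ "\<Sum>b\<in>Basis. \<Sum>c\<in>Basis. M b c"]) (auto intro!: sum_nonneg)
qed

section \<open>Taylor expansion along a line\<close>

lemma dirderiv_line:
  assumes "\<And>x. g differentiable (at x)"
  shows "((\<lambda>t. g (x + t *\<^sub>R v)) has_real_derivative dirderiv v g (x + t *\<^sub>R v)) (at t)"
proof -
  have "((\<lambda>t. g (x + t *\<^sub>R v)) has_derivative (\<lambda>s. dirderiv (s *\<^sub>R v) g (x + t *\<^sub>R v))) (at t)"
    by (rule has_derivative_compose[of "\<lambda>t. x + t *\<^sub>R v" "\<lambda>s. s *\<^sub>R v" t UNIV g, simplified])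
      (auto intro!: derivative_eq_intros has_derivative_dirderiv assms)
  moreover have "dirderiv (s *\<^sub>R v) g (x + t *\<^sub>R v) = dirderiv v g (x + t *\<^sub>R v) * s" for s
    using linear_cmul[OF has_derivative_linear[OF has_derivative_dirderiv[OF assms[of "x + t *\<^sub>R v"]]], of s v]
    by simp
  ultimately show ?thesis
    by (simp add: has_field_derivative_def mult_commute_abs)
qed

text \<open>The two-sided Maclaurin formula admits negative \<open>h\<close>; expansions at
  \<open>h\<close> and \<open>- h\<close> are later added to form second differences.\<close>

lemma taylor_dirderiv:
  assumes "smooth g"
  obtains t where "\<bar>t\<bar> \<le> \<bar>h\<bar>"
    "g (x + h *\<^sub>R v) = g x + h * dirderiv v g x + h\<^sup>2 / 2 * dirderiv v (dirderiv v g) (x + t *\<^sub>R v)"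
proof -
  define df where "df m t = (if m = 0 then g (x + t *\<^sub>R v) else if m = Suc 0 then dirderiv v g (x + t *\<^sub>R v)
    else dirderiv v (dirderiv v g) (x + t *\<^sub>R v))" for m :: nat and t :: real
  have "\<forall>m t. m < 2 \<and> \<bar>t\<bar> \<le> \<bar>h\<bar> \<longrightarrow> DERIV (df m) t :> df (Suc m) t"
    unfolding df_def less_2_cases_iff
    by (auto intro!: dirderiv_line smooth_differentiable smooth_dirderiv assms)
  from Maclaurin_bi_le[OF _ this, of "df 0"] obtain t where
    "\<bar>t\<bar> \<le> \<bar>h\<bar>" "df 0 h = (\<Sum>m<2. df m 0 / fact m * h ^ m) + df 2 t / fact 2 * h ^ 2"
    by auto
  then show thesis
    by (intro that[of t]) (auto simp: df_def numeral_2_eq_2 mult.commute)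
qed

section \<open>Bump functions\<close>

text \<open>The powers in the denominator make the family closed under differentiation up to linear
  combinations; \<open>flat 0\<close> is the classical exp(-1/t) extended by zero.\<close>

definition flat :: "nat \<Rightarrow> real \<Rightarrow> real" where
  "flat k t = (if t > 0 then exp (- 1 / t) / t ^ k else 0)"

text \<open>With \<open>t = 1 / x\<close> this is the decay of \<open>x ^ k / exp x\<close> at
  infinity.\<close>

lemma flat_tendsto_0: "(flat k \<longlongrightarrow> 0) (at_right 0)"
  unfolding filterlim_at_right_to_top
proof (rule Lim_transform_eventually[OF tendsto_power_div_exp_0[of k]])
  show "\<forall>\<^sub>F x in at_top. x ^ k / exp x = flat k (inverse x)"
    using eventually_gt_at_top[of 0]
    by eventually_elim (simp add: flat_def exp_minus field_simps)
qed

lemma flat_has_derivative: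
  "(flat k has_real_derivative flat (k + 2) t - real k * flat (Suc k) t) (at t)"
proof -
  consider "t > 0" | "t = 0" | "t < 0" by linarith
  then show ?thesis
  proof cases
    case 1
    have "((\<lambda>t. exp (- 1 / t) / t ^ k) has_real_derivative flat (k + 2) t - real k * flat (Suc k) t) (at t)"
    proof (rule DERIV_cong[OF DERIV_divide])
      show "((\<lambda>t. exp (- 1 / t)) has_real_derivative exp (- 1 / t) / t\<^sup>2) (at t)"
        using 1 by (auto intro!: derivative_eq_intros simp: power2_eq_square)
      show "((\<lambda>t. t ^ k) has_real_derivative real k * t ^ k / t) (at t)"
        by (rule DERIV_cong[OF DERIV_pow]) (use 1 in \<open>cases k; simp\<close>)
    qed (use 1 in \<open>auto simp: flat_def field_simps power2_eq_square\<close>)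
    then show ?thesis
      by (rule has_field_derivative_transform_within_open[of _ _ _ "{0<..}"])
        (use 1 in \<open>auto simp: flat_def\<close>)
  next
    case 2
    \<comment> \<open>At 0 the difference quotient from the right is \<open>flat (Suc k)\<close>,
      which tends to 0; from the left it vanishes identically.\<close>
    have "((\<lambda>h. (flat k (0 + h) - flat k 0) / h) \<longlongrightarrow> 0) (at 0)"
    proof (rule filterlim_split_at)
      show "((\<lambda>h. (flat k (0 + h) - flat k 0) / h) \<longlongrightarrow> 0) (at_left 0)"
        by (rule Lim_transform_eventually[OF tendsto_const[of 0]])
          (auto simp: flat_def eventually_at_filter)
      show "((\<lambda>h. (flat k (0 + h) - flat k 0) / h) \<longlongrightarrow> 0) (at_right 0)"
        by (rule Lim_transform_eventually[OF flat_tendsto_0[of "Suc k"]])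
          (auto simp: flat_def eventually_at_filter field_simps)
    qed
    then show ?thesis using 2 by (simp add: DERIV_def flat_def)
  next
    case 3
    have "((\<lambda>t. 0) has_real_derivative flat (k + 2) t - real k * flat (Suc k) t) (at t)"
      using 3 by (auto simp: flat_def)
    then show ?thesis
      by (rule has_field_derivative_transform_within_open[of _ _ _ "{..<0}"])
        (use 3 in \<open>auto simp: flat_def\<close>)
  qed
qed

text \<open>Tailored to be the witness class in \<open>smooth\<close>: closed under differentiation,
  which replaces a general calculus of smooth products and compositions. The parameter
  \<open>c\<close> becomes the squared radius of the bump.\<close>

inductive bump_alg :: "real \<Rightarrow> ('a::euclidean_space \<Rightarrow> real) \<Rightarrow> bool" for c :: real where
  flat: "bump_alg c (\<lambda>x. flat k (c - x \<bullet> x))"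
| const: "bump_alg c (\<lambda>x. a)"
| inner: "bump_alg c (\<lambda>x. x \<bullet> v)"
| add: "bump_alg c f \<Longrightarrow> bump_alg c g \<Longrightarrow> bump_alg c (\<lambda>x. f x + g x)"
| mult: "bump_alg c f \<Longrightarrow> bump_alg c g \<Longrightarrow> bump_alg c (\<lambda>x. f x * g x)"

text \<open>Induction along the construction: the chain rule on a generator yields
  \<open>flat\<close> at higher indices times a linear factor, and the product rule stays inside the
  algebra.\<close>

lemma bump_alg_derivative:
  "bump_alg c h \<Longrightarrow> \<exists>h'. (\<forall>v. bump_alg c (h' v)) \<and> (\<forall>x. (h has_derivative (\<lambda>v. h' v x)) (at x))"
proof (induction rule: bump_alg.induct)
  case (flat k)
  let ?h = "\<lambda>v x. (flat (k + 2) (c - x \<bullet> x) + - real k * flat (Suc k) (c - x \<bullet> x)) * (- 2 * (x \<bullet> v))"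
  have "((\<lambda>x. flat k (c - x \<bullet> x)) has_derivative (\<lambda>v. ?h v x)) (at x)" for x :: 'a
  proof -
    have "((\<lambda>x. c - x \<bullet> x) has_derivative (\<lambda>v. 0 - (x \<bullet> v + v \<bullet> x))) (at x)"
      by (intro has_derivative_diff has_derivative_const has_derivative_inner has_derivative_ident)
    from has_derivative_compose[OF this flat_has_derivative[THEN has_field_derivative_imp_has_derivative]]
    show ?thesis
      by (rule has_derivative_eq_rhs) (auto simp: inner_commute fun_eq_iff algebra_simps)
  qed
  moreover have "bump_alg c (?h v)" for v :: 'a
    by (intro bump_alg.intros)
  ultimately show ?case by (intro exI[of _ ?h]) blast
next
  case (const a)
  show ?case by (intro exI[of _ "\<lambda>v x. 0"]) (auto intro: bump_alg.intros)
next
  case (inner v)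
  show ?case
    by (intro exI[of _ "\<lambda>u x. u \<bullet> v"]) (auto intro!: bump_alg.intros derivative_eq_intros)
next
  case (add f g)
  then obtain f' g' where "\<And>v. bump_alg c (f' v)" "\<And>v. bump_alg c (g' v)"
    "\<And>x. (f has_derivative (\<lambda>v. f' v x)) (at x)" "\<And>x. (g has_derivative (\<lambda>v. g' v x)) (at x)"
    by blast
  then show ?case
    by (intro exI[of _ "\<lambda>v x. f' v x + g' v x"]) (auto intro!: bump_alg.intros has_derivative_add)
next
  case (mult f g)
  then obtain f' g' where "\<And>v. bump_alg c (f' v)" "\<And>v. bump_alg c (g' v)"
    "\<And>x. (f has_derivative (\<lambda>v. f' v x)) (at x)" "\<And>x. (g has_derivative (\<lambda>v. g' v x)) (at x)"
    by blast
  then show ?case using mult.hyps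
    by (intro exI[of _ "\<lambda>v x. f x * g' v x + f' v x * g x"])
      (auto intro!: bump_alg.intros has_derivative_mult)
qed

lemma bump_alg_smooth:
  assumes "bump_alg c h"
  shows "smooth h"
  unfolding smooth_def
proof (intro exI[of _ "Collect (bump_alg c)"] conjI ballI allI)
  fix h :: "'a \<Rightarrow> real" and x v assume "h \<in> Collect (bump_alg c)"
  then obtain h' where h': "\<And>v. bump_alg c (h' v)" "\<And>x. (h has_derivative (\<lambda>v. h' v x)) (at x)"
    using bump_alg_derivative by blast
  show "h differentiable at x"
    using h'(2) by (rule differentiableI)
  have "dirderiv v h = h' v"
    using dirderiv_eqI[OF h'(2)] by blast
  then show "dirderiv v h \<in> Collect (bump_alg c)"
    using h'(1) by simp
qed (use assms in simp)

text \<open>The classical bump exp(-1/(r^2 - |x|^2)). It is left unnormalised, since later only the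
  positivity of its integral matters.\<close>

lemma bump_exists:
  assumes "r > 0"
  obtains \<rho> :: "'a::euclidean_space \<Rightarrow> real" where "test_function \<rho>" "\<And>x. \<rho> x \<ge> 0"
    "\<And>x. r \<le> norm x \<Longrightarrow> \<rho> x = 0" "(LINT x|lborel. \<rho> x) > 0"
proof
  let ?\<rho> = "\<lambda>x::'a. flat 0 (r\<^sup>2 - x \<bullet> x)"
  have pos: "?\<rho> x \<noteq> 0 \<longleftrightarrow> norm x < r" for x
    using assms power2_less_imp_less[of "norm x" r] power_strict_mono[of "norm x" r 2]
    by (auto simp: flat_def power2_norm_eq_inner)
  then show zero: "?\<rho> x = 0" if "r \<le> norm x" for x
    using that by (meson not_less)
  show nonneg: "?\<rho> x \<ge> 0" for x by (simp add: flat_def)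
  show test: "test_function ?\<rho>"
    unfolding test_function_iff using zero bump_alg_smooth[OF bump_alg.flat]
    by (metis less_imp_le)
  show "(LINT x|lborel. ?\<rho> x) > 0"
  proof (rule ccontr)
    assume "\<not> (LINT x|lborel. ?\<rho> x) > 0"
    \<comment> \<open>A nonnegative function with zero integral vanishes almost everywhere, which
      would make the ball where \<open>?\<rho>\<close> is nonzero a null set.\<close>
    then have "(LINT x|lborel. ?\<rho> x) = 0"
      using nonneg by (simp add: order.antisym integral_nonneg_AE not_less)
    then have "AE x in lborel. ?\<rho> x = 0"
      using integral_nonneg_eq_0_iff_AE[OF test_function_integrable[OF test]] nonneg by simp
    then have "{x. ?\<rho> x \<noteq> 0} \<in> null_sets lborel"
      using test_function_measurable[OF test] by (subst (asm) AE_iff_null) auto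
    then have "ball (0::'a) r \<in> null_sets lborel"
      unfolding pos by (simp add: ball_def)
    then have "negligible (ball (0::'a) r)"
      by (simp add: negligible_iff_null_sets null_sets_completionI)
    then show False using open_not_negligible[of "ball (0::'a) r"] assms by simp
  qed
qed

section \<open>Continuity of translation in the mean\<close>

lemma lborel_integrable_shift:
  fixes f :: "'a::euclidean_space \<Rightarrow> real"
  assumes "integrable lborel f"
  shows "integrable lborel (\<lambda>x. f (x + a))"
proof -
  have "integrable (distr lborel borel ((+) a)) f"
    using assms by (simp add: lborel_distr_plus)
  then show ?thesis
    by (subst (asm) integrable_distr_eq) (use assms in \<open>auto simp: add.commute dest: borel_measurable_integrable\<close>)
qed

lemma lborel_integral_shift:
  fixes f :: "'a::euclidean_space \<Rightarrow> real"
  assumes "f \<in> borel_measurable borel"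
  shows "(LINT x|lborel. f (x + a)) = (LINT x|lborel. f x)"
proof -
  have "(LINT x|lborel. f x) = (LINT x|distr lborel borel ((+) a). f x)"
    by (simp add: lborel_distr_plus)
  also have "\<dots> = (LINT x|lborel. f (x + a))"
    by (subst integral_distr) (use assms in \<open>auto simp: add.commute\<close>)
  finally show ?thesis by simp
qed

text \<open>Phrased with sequences because dominated convergence is applied along sequences;
  \<open>L1_continuousE\<close> returns to the form with a radius.\<close>

definition L1_continuous :: "('a::euclidean_space \<Rightarrow> real) \<Rightarrow> bool" where
  "L1_continuous f \<longleftrightarrow> (\<forall>a. a \<longlonglongrightarrow> 0 \<longrightarrow> (\<lambda>n. LINT x|lborel. \<bar>f (x + a n) - f x\<bar>) \<longlonglongrightarrow> 0)"

text \<open>An \<open>e / 3\<close> argument, in which translation invariance makes the two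
  approximation errors equal.\<close>

lemma L1_continuous_approx:
  fixes f :: "'a::euclidean_space \<Rightarrow> real"
  assumes [simp]: "integrable lborel f"
    and approx: "\<And>e. e > 0 \<Longrightarrow> \<exists>g. integrable lborel g \<and> L1_continuous g \<and> (LINT x|lborel. \<bar>f x - g x\<bar>) < e"
  shows "L1_continuous f"
  unfolding L1_continuous_def
proof (intro allI impI LIMSEQ_I)
  fix a :: "nat \<Rightarrow> 'a" and e :: real
  assume a: "a \<longlonglongrightarrow> 0" and "e > 0"
  then obtain g where [simp]: "integrable lborel g" and g: "L1_continuous g" "(LINT x|lborel. \<bar>f x - g x\<bar>) < e / 3"
    using approx[of "e / 3"] by auto
  note [simp] = lborel_integrable_shift
  have "(\<lambda>n. LINT x|lborel. \<bar>g (x + a n) - g x\<bar>) \<longlonglongrightarrow> 0"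
    using g(1) a by (simp add: L1_continuous_def)
  from LIMSEQ_D[OF this, of "e / 3"] \<open>e > 0\<close>
  obtain N where N: "\<And>n. n \<ge> N \<Longrightarrow> norm ((LINT x|lborel. \<bar>g (x + a n) - g x\<bar>) - 0) < e / 3"
    by auto
  have "norm ((LINT x|lborel. \<bar>f (x + a n) - f x\<bar>) - 0) < e" if "n \<ge> N" for n
  proof -
    have "(LINT x|lborel. \<bar>f (x + a n) - f x\<bar>) \<le>
        (LINT x|lborel. \<bar>f (x + a n) - g (x + a n)\<bar> + \<bar>g (x + a n) - g x\<bar> + \<bar>f x - g x\<bar>)"
      by (intro integral_mono) auto
    also have "\<dots> = (LINT x|lborel. \<bar>f (x + a n) - g (x + a n)\<bar>) + (LINT x|lborel. \<bar>g (x + a n) - g x\<bar>)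
        + (LINT x|lborel. \<bar>f x - g x\<bar>)"
      by simp
    also have "(LINT x|lborel. \<bar>f (x + a n) - g (x + a n)\<bar>) = (LINT x|lborel. \<bar>f x - g x\<bar>)"
      using borel_measurable_integrable[of lborel f] borel_measurable_integrable[of lborel g]
      by (intro lborel_integral_shift[of "\<lambda>x. \<bar>f x - g x\<bar>"]) auto
    finally show ?thesis
      using N[OF that] g(2) by simp
  qed
  then show "\<exists>N. \<forall>n\<ge>N. norm ((LINT x|lborel. \<bar>f (x + a n) - f x\<bar>) - 0) < e" by blast
qed

text \<open>Openness gives one half: a point of \<open>U\<close> stays in \<open>U\<close> under
  small translations, so the overlap integral tends to the measure of \<open>U\<close>. The other
  half is that translates of \<open>U\<close> have the same measure, which enters in
  \<open>eq\<close>.\<close>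

lemma L1_continuous_open:
  fixes U :: "'a::euclidean_space set"
  assumes "open U" "emeasure lborel U < \<infinity>"
  shows "L1_continuous (indicator U)"
  unfolding L1_continuous_def
proof (intro allI impI)
  fix a :: "nat \<Rightarrow> 'a" assume a: "a \<longlonglongrightarrow> 0"
  have [measurable]: "U \<in> sets borel" using assms(1) by simp
  have [simp]: "integrable lborel (indicator U :: 'a \<Rightarrow> real)"
    using assms by (intro integrable_real_indicator) auto
  note [simp] = lborel_integrable_shift[of "indicator U"]
  have [simp]: "integrable lborel (\<lambda>x. indicator U x * indicator U (x + b) :: real)" for b
    by (rule Bochner_Integration.integrable_bound[of lborel "indicator U :: 'a \<Rightarrow> real"]) (auto simp: indicator_def)
  have lim: "(\<lambda>n. LINT x|lborel. indicator U x * indicator U (x + a n) :: real) \<longlonglongrightarrow> (LINT x|lborel. indicator U x)"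
  proof (rule integral_dominated_convergence[where w="indicator U"])
    have "(\<lambda>n. indicator U x * indicator U (x + a n)) \<longlonglongrightarrow> (indicator U x :: real)" for x
    proof (cases "x \<in> U")
      case True
      have "(\<lambda>n. x + a n) \<longlonglongrightarrow> x" using tendsto_add[OF tendsto_const a, of x] by simp
      then have "\<forall>\<^sub>F n in sequentially. x + a n \<in> U"
        using assms(1) True by (rule topological_tendstoD)
      then show ?thesis
        using True by (intro tendsto_eventually) (auto elim!: eventually_mono)
    qed simp
    then show "AE x in lborel. (\<lambda>n. indicator U x * indicator U (x + a n)) \<longlonglongrightarrow> (indicator U x :: real)"
      by simp
  qed (auto simp: indicator_def)
  have eq: "(LINT x|lborel. \<bar>indicator U (x + b) - indicator U x\<bar>)
      = 2 * (LINT x|lborel. indicator U x) - 2 * (LINT x|lborel. indicator U x * indicator U (x + b) :: real)" for b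
  proof -
    have "(LINT x|lborel. \<bar>indicator U (x + b) - indicator U x\<bar>)
      = (LINT x|lborel. indicator U (x + b) + indicator U x - 2 * (indicator U x * indicator U (x + b) :: real))"
      by (intro Bochner_Integration.integral_cong) (auto simp: indicator_def)
    also have "\<dots> = 2 * (LINT x|lborel. indicator U x) - 2 * (LINT x|lborel. indicator U x * indicator U (x + b) :: real)"
      by (simp add: lborel_integral_shift)
    finally show ?thesis .
  qed
  show "(\<lambda>n. LINT x|lborel. \<bar>indicator U (x + a n) - indicator U x\<bar> :: real) \<longlonglongrightarrow> 0"
    unfolding eq using tendsto_diff[OF tendsto_const tendsto_mult_left[OF lim, of 2], of "2 * (LINT x|lborel. indicator U x)"]
    by simp
qed

text \<open>Outer regularity supplies an open \<open>U\<close> containing \<open>A\<close> with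
  excess below \<open>e\<close>, and the L1 distance of the indicators is exactly this
  excess.\<close>

lemma L1_continuous_indicator:
  fixes A :: "'a::euclidean_space set"
  assumes [measurable]: "A \<in> sets borel" and fin: "emeasure lborel A < \<infinity>"
  shows "L1_continuous (indicator A)"
proof (rule L1_continuous_approx)
  show iA: "integrable lborel (indicator A :: 'a \<Rightarrow> real)"
    using assms by (intro integrable_real_indicator) auto
  fix e :: real assume "e > 0"
  obtain U where U: "open U" "A \<subseteq> U" "emeasure lborel (U - A) < e"
    using outer_regular_lborel[OF assms(1) \<open>e > 0\<close>] by blast
  have [measurable]: "U \<in> sets borel" using U(1) by simp
  have "emeasure lborel U = emeasure lborel A + emeasure lborel (U - A)"
    using U(2) by (subst plus_emeasure) (auto simp: Un_absorb1)
  also have "\<dots> < \<infinity>"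
    using fin U(3) by (metis ennreal_add_less_top ennreal_less_top infinity_ennreal_def less_trans)
  finally have finU: "emeasure lborel U < \<infinity>" .
  have "(LINT x|lborel. \<bar>indicator A x - indicator U x\<bar> :: real) = (LINT x|lborel. indicator (U - A) x)"
    using U(2) by (intro Bochner_Integration.integral_cong) (auto simp: indicator_def)
  also have "\<dots> = measure lborel (U - A)" by simp
  also have "\<dots> < e"
  proof -
    have "emeasure lborel (U - A) \<noteq> top"
      using U(3) less_trans[OF _ ennreal_less_top] by auto
    then have "ennreal (measure lborel (U - A)) < ennreal e"
      using U(3) by (simp add: emeasure_eq_ennreal_measure)
    then show ?thesis by (simp add: ennreal_less_iff)
  qed
  finally show "\<exists>g. integrable lborel g \<and> L1_continuous g \<and> (LINT x|lborel. \<bar>indicator A x - g x\<bar>) < e"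
    using L1_continuous_open[OF U(1) finU] finU
    by (intro exI[of _ "indicator U"]) (auto intro!: integrable_real_indicator)
qed

lemma integrable_L1_continuous:
  fixes f :: "'a::euclidean_space \<Rightarrow> real"
  assumes "integrable lborel f"
  shows "L1_continuous f"
  using assms
proof (induction rule: integrable_induct)
  case (base A c)
  then have A: "L1_continuous (indicator A :: 'a \<Rightarrow> real)"
    by (intro L1_continuous_indicator) auto
  have eq: "\<bar>indicator A (x + b) *\<^sub>R c - indicator A x *\<^sub>R c\<bar> = \<bar>c\<bar> * \<bar>indicator A (x + b) - indicator A x\<bar>" for x b
    by (simp add: abs_mult[symmetric] algebra_simps)
  show ?case
    unfolding L1_continuous_def eq integral_mult_right_zero
    using A by (auto simp: L1_continuous_def intro!: tendsto_mult_right_zero)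
next
  case (add f g)
  note [simp] = add.hyps lborel_integrable_shift
  show ?case
    unfolding L1_continuous_def
  proof (intro allI impI)
    fix a :: "nat \<Rightarrow> 'a" assume a: "a \<longlonglongrightarrow> 0"
    have lim: "(\<lambda>n. (LINT x|lborel. \<bar>f (x + a n) - f x\<bar>) + (LINT x|lborel. \<bar>g (x + a n) - g x\<bar>)) \<longlonglongrightarrow> 0"
      using add.IH a unfolding L1_continuous_def by (intro tendsto_add_zero) auto
    have "(LINT x|lborel. \<bar>f (x + a n) + g (x + a n) - (f x + g x)\<bar>)
        \<le> (LINT x|lborel. \<bar>f (x + a n) - f x\<bar> + \<bar>g (x + a n) - g x\<bar>)" for n
      by (intro integral_mono) auto
    then show "(\<lambda>n. LINT x|lborel. \<bar>f (x + a n) + g (x + a n) - (f x + g x)\<bar>) \<longlonglongrightarrow> 0"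
      by (intro tendsto_sandwich[OF _ _ tendsto_const lim]) (auto intro!: always_eventually)
  qed
next
  case (lim f s)
  note [simp] = lim.hyps(1) lim.hyps(4)
  have [measurable]: "f \<in> borel_measurable lborel" "\<And>i. s i \<in> borel_measurable lborel"
    using borel_measurable_integrable[OF lim.hyps(4)] borel_measurable_integrable[OF lim.hyps(1)] by simp_all
  have "(\<lambda>i. LINT x|lborel. \<bar>f x - s i x\<bar>) \<longlonglongrightarrow> integral\<^sup>L lborel (\<lambda>x::'a. 0::real)"
  \<comment> \<open>The approximants of \<open>integrable_induct\<close> satisfy
    \<open>\<bar>s i x\<bar> \<le> 2 * \<bar>f x\<bar>\<close>; the triangle inequality adds one
    more \<open>\<bar>f x\<bar>\<close>.\<close>
  proof (rule integral_dominated_convergence[where w="\<lambda>x. 3 * \<bar>f x\<bar>"])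
    show "AE x in lborel. (\<lambda>i. \<bar>f x - s i x\<bar>) \<longlonglongrightarrow> 0"
    proof (intro AE_I2 tendsto_rabs_zero)
      fix x
      have "(\<lambda>i. f x - s i x) \<longlonglongrightarrow> f x - f x"
        by (intro tendsto_diff tendsto_const lim.hyps(2)) simp
      then show "(\<lambda>i. f x - s i x) \<longlonglongrightarrow> 0" by simp
    qed
    show "AE x in lborel. norm \<bar>f x - s i x\<bar> \<le> 3 * \<bar>f x\<bar>" for i
    proof (intro AE_I2)
      fix x
      show "norm \<bar>f x - s i x\<bar> \<le> 3 * \<bar>f x\<bar>"
        using lim.hyps(3)[of x i] abs_triangle_ineq4[of "f x" "s i x"] by simp
    qed
  qed auto
  then have "\<exists>i. (LINT x|lborel. \<bar>f x - s i x\<bar>) < e" if "e > 0" for e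
    using order_tendstoD(2)[of _ 0 sequentially e] that
    by (force dest: eventually_happens)
  then show ?case
    using lim.IH lim.hyps(1) by (intro L1_continuous_approx lim.hyps(4)) blast
qed

lemma L1_continuousE:
  fixes f :: "'a::euclidean_space \<Rightarrow> real"
  assumes "integrable lborel f" "e > 0"
  obtains d where "d > 0" "\<And>a. norm a < d \<Longrightarrow> (LINT x|lborel. \<bar>f (x + a) - f x\<bar>) < e"
proof (rule ccontr)
  assume "\<not> thesis"
  with that have "\<forall>d>0. \<exists>a. norm a < d \<and> \<not> (LINT x|lborel. \<bar>f (x + a) - f x\<bar>) < e"
    by blast
  then have "\<forall>n. \<exists>a. norm a < inverse (real (Suc n)) \<and> \<not> (LINT x|lborel. \<bar>f (x + a) - f x\<bar>) < e"
    by simp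
  then obtain a where a: "\<And>n. norm (a n) < inverse (real (Suc n))"
      "\<And>n. \<not> (LINT x|lborel. \<bar>f (x + a n) - f x\<bar>) < e"
    by metis
  have "a \<longlonglongrightarrow> 0"
    by (rule Lim_null_comparison[OF _ LIMSEQ_inverse_real_of_nat])
      (use a(1) in \<open>auto intro!: always_eventually less_imp_le\<close>)
  then have "(\<lambda>n. LINT x|lborel. \<bar>f (x + a n) - f x\<bar>) \<longlonglongrightarrow> 0"
    using integrable_L1_continuous[OF assms(1)] by (simp add: L1_continuous_def)
  then show False
    using order_tendstoD(2)[OF _ assms(2)] a(2) by (force dest: eventually_happens)
qed

section \<open>Second differences and the Levy operator\<close>

definition second_diff :: "'a::euclidean_space \<Rightarrow> ('a \<Rightarrow> real) \<Rightarrow> 'a \<Rightarrow> real" where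
  "second_diff z \<psi> x = \<psi> (x + z) + \<psi> (x - z) - 2 * \<psi> x"

lemma taylor_bound:
  fixes \<psi> :: "'a::euclidean_space \<Rightarrow> real"
  assumes "test_function \<psi>"
  obtains M where "M \<ge> 0" "\<And>x z. \<bar>\<psi> (x + z) - \<psi> x - z \<bullet> grad \<psi> x\<bar> \<le> M * (norm z)\<^sup>2"
proof -
  obtain M where M: "M \<ge> 0" "\<And>v x. \<bar>dirderiv v (dirderiv v \<psi>) x\<bar> \<le> M * (norm v)\<^sup>2"
    using dirderiv2_bounded[OF assms] by blast
  have "\<bar>\<psi> (x + z) - \<psi> x - z \<bullet> grad \<psi> x\<bar> \<le> M * (norm z)\<^sup>2" for x z
  proof -
    obtain t where "\<psi> (x + 1 *\<^sub>R z) = \<psi> x + 1 * dirderiv z \<psi> x + 1\<^sup>2 / 2 * dirderiv z (dirderiv z \<psi>) (x + t *\<^sub>R z)"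
      using taylor_dirderiv[OF test_function_smooth[OF assms], of 1 x z] by blast
    then have "\<psi> (x + z) - \<psi> x - z \<bullet> grad \<psi> x = dirderiv z (dirderiv z \<psi>) (x + t *\<^sub>R z) / 2"
      using inner_grad[OF smooth_differentiable[OF test_function_smooth[OF assms]]] by simp
    then show ?thesis
      using M(2)[of z "x + t *\<^sub>R z"] M(1) by (simp add: abs_if split: if_splits)
  qed
  with M(1) that show thesis by blast
qed

text \<open>The gradient terms at \<open>z\<close> and \<open>- z\<close> cancel, leaving two Taylor
  remainders; hence the doubled constant.\<close>

lemma second_diff_bound:
  fixes \<psi> :: "'a::euclidean_space \<Rightarrow> real"
  assumes "test_function \<psi>"
  obtains M where "M \<ge> 0" "\<And>x z. \<bar>second_diff z \<psi> x\<bar> \<le> M * (norm z)\<^sup>2"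
proof -
  obtain M where M: "M \<ge> 0" "\<And>x z. \<bar>\<psi> (x + z) - \<psi> x - z \<bullet> grad \<psi> x\<bar> \<le> M * (norm z)\<^sup>2"
    using taylor_bound[OF assms] by blast
  have "\<bar>second_diff z \<psi> x\<bar> \<le> (2 * M) * (norm z)\<^sup>2" for x z
    using M(2)[of x z] M(2)[of x "- z"] by (simp add: second_diff_def)
  with that[of "2 * M"] M(1) show thesis by auto
qed

lemma second_diff_zero_outside:
  assumes "\<And>x. R < norm x \<Longrightarrow> \<psi> x = 0" "R + norm z < norm x"
  shows "second_diff z \<psi> x = 0"
proof -
  have "R < norm (x + z)" "R < norm (x - z)" "R < norm x"
    using norm_triangle_ineq4[of "x + z" z] norm_triangle_ineq[of "x - z" z] assms(2) norm_ge_zero[of z]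
    by simp_all (use norm_ge_zero[of z] in linarith)
  then show ?thesis by (simp add: second_diff_def assms(1))
qed

section \<open>Levy measures and the symmetrised form of the operator\<close>

lemma levy_measure_integrable:
  assumes "levy_measure \<mu>"
  shows "integrable \<mu> (\<lambda>z. min ((norm z)\<^sup>2) 1)"
proof (rule integrableI_bounded)
  have [measurable_cong]: "sets \<mu> = sets borel" using assms by (simp add: levy_measure_def)
  show "(\<lambda>z. min ((norm z)\<^sup>2) 1) \<in> borel_measurable \<mu>" by measurable
qed (use assms in \<open>simp add: levy_measure_def\<close>)

text \<open>Prerequisite for Fubini. By a Markov estimate the superlevel sets of
  \<open>min ((norm z)\<^sup>2) 1\<close> have finite measure; they exhaust all but the origin, a
  null set that is added by hand.\<close>

lemma levy_measure_sigma_finite: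
  fixes \<mu> :: "'a::euclidean_space measure"
  assumes "levy_measure \<mu>"
  shows "sigma_finite_measure \<mu>"
proof
  have [measurable_cong]: "sets \<mu> = sets borel" using assms by (simp add: levy_measure_def)
  then have [simp]: "space \<mu> = UNIV" using sets_eq_imp_space_eq by force
  define A where "A n = {z::'a. min ((norm z)\<^sup>2) 1 \<ge> inverse (real (Suc n))}" for n
  have A: "A n \<in> sets \<mu>" for n
    unfolding A_def \<open>sets \<mu> = sets borel\<close> by measurable
  have "emeasure \<mu> (A n) \<noteq> \<infinity>" for n
  proof -
    have "emeasure \<mu> (A n) = (\<integral>\<^sup>+z. indicator (A n) z \<partial>\<mu>)"
      using A by simp
    also have "\<dots> \<le> (\<integral>\<^sup>+z. ennreal (Suc n) * ennreal (min ((norm z)\<^sup>2) 1) \<partial>\<mu>)"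
    proof (intro nn_integral_mono)
      fix z
      have "ennreal 1 \<le> ennreal (Suc n) * ennreal (min ((norm z)\<^sup>2) 1)" if "z \<in> A n"
      proof -
        have "1 \<le> real (Suc n) * min ((norm z)\<^sup>2) 1"
          using that unfolding A_def by (simp only: mem_Collect_eq) (simp add: inverse_eq_divide divide_le_eq mult.commute del: of_nat_Suc min.bounded_iff)
        then show ?thesis by (subst ennreal_mult[symmetric]) (auto intro!: ennreal_leI)
      qed
      then show "indicator (A n) z \<le> ennreal (Suc n) * ennreal (min ((norm z)\<^sup>2) 1)"
        by (auto simp: indicator_def)
    qed
    also have "\<dots> = ennreal (Suc n) * (\<integral>\<^sup>+z. ennreal (min ((norm z)\<^sup>2) 1) \<partial>\<mu>)"
      by (rule nn_integral_cmult) simp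
    also have "\<dots> < \<infinity>"
      using assms unfolding levy_measure_def by (simp add: ennreal_mult_less_top)
    finally show ?thesis by simp
  qed
  moreover have "insert {0} (range A) \<subseteq> sets \<mu>" "emeasure \<mu> {0} \<noteq> \<infinity>"
    using A assms by (auto simp: levy_measure_def)
  moreover have cover: "z \<in> \<Union> (insert {0} (range A))" for z
  proof (cases "z = 0")
    case False
    then obtain n where "inverse (real (Suc n)) < min ((norm z)\<^sup>2) 1"
      using reals_Archimedean[of "min ((norm z)\<^sup>2) 1"] by auto
    then have "z \<in> A n" unfolding A_def by (simp del: of_nat_Suc)
    then show ?thesis by blast
  qed simp
  ultimately show "\<exists>A. countable A \<and> A \<subseteq> sets \<mu> \<and> \<Union> A = space \<mu> \<and> (\<forall>a\<in>A. emeasure \<mu> a \<noteq> \<infinity>)"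
    by (intro exI[of _ "insert {0} (range A)"]) (use cover in \<open>simp, blast\<close>)
qed

text \<open>Symmetry on sets says that \<open>\<mu>\<close> is its own image under negation; both
  claims are then the transformation formula.\<close>

lemma levy_measure_integral_uminus:
  fixes \<mu> :: "'a::euclidean_space measure" and g :: "'a \<Rightarrow> real"
  assumes "levy_measure \<mu>"
  shows "integrable \<mu> g \<Longrightarrow> integrable \<mu> (\<lambda>z. g (- z))"
    and "integrable \<mu> g \<Longrightarrow> (LINT z|\<mu>. g (- z)) = (LINT z|\<mu>. g z)"
proof -
  have [measurable_cong]: "sets \<mu> = sets borel" using assms by (simp add: levy_measure_def)
  then have [simp]: "space \<mu> = UNIV" using sets_eq_imp_space_eq by force
  have distr: "distr \<mu> \<mu> uminus = \<mu>"
  proof (rule measure_eqI)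
    fix A assume "A \<in> sets (distr \<mu> \<mu> uminus)"
    then have A: "A \<in> sets borel" using \<open>sets \<mu> = sets borel\<close> by simp
    have "uminus -` A = uminus ` A" by force
    then show "emeasure (distr \<mu> \<mu> uminus) A = emeasure \<mu> A"
      using assms A unfolding levy_measure_def by (subst emeasure_distr) auto
  qed simp
  have m: "uminus \<in> measurable \<mu> \<mu>" by measurable
  show "integrable \<mu> g \<Longrightarrow> integrable \<mu> (\<lambda>z. g (- z))"
    using integrable_distr[of uminus \<mu> \<mu> g] distr m by simp
  show "(LINT z|\<mu>. g (- z)) = (LINT z|\<mu>. g z)" if "integrable \<mu> g"
    using integral_distr[OF m borel_measurable_integrable[OF that]] distr by simp
qed

text \<open>Averaging over \<open>z\<close> and \<open>- z\<close>, which symmetry permits, cancels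
  the odd gradient term. The compensated integrand \<open>G\<close> is integrable by itself, so the
  two integrals may be added.\<close>

lemma nonlocal_op_eq:
  fixes \<mu> :: "'a::euclidean_space measure"
  assumes \<mu>: "levy_measure \<mu>" and \<psi>: "test_function \<psi>"
  shows "nonlocal_op \<mu> \<psi> x = (LINT z|\<mu>. second_diff z \<psi> x) / 2"
proof -
  have [measurable_cong]: "sets \<mu> = sets borel" using \<mu> by (simp add: levy_measure_def)
  note [measurable] = test_function_measurable[OF \<psi>]
  define G where "G z = \<psi> (x + z) - \<psi> x - (if norm z \<le> 1 then z \<bullet> grad \<psi> x else 0)" for z
  obtain M where M: "M \<ge> 0" "\<And>x z. \<bar>\<psi> (x + z) - \<psi> x - z \<bullet> grad \<psi> x\<bar> \<le> M * (norm z)\<^sup>2"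
    using taylor_bound[OF \<psi>] by blast
  obtain B where B: "B \<ge> 0" "\<And>x. \<bar>\<psi> x\<bar> \<le> B"
    using test_function_bounded[OF \<psi>] by blast
  \<comment> \<open>\<open>M\<close> pays for the Taylor remainder at small jumps,
    \<open>2 * B\<close> for the plain difference at large ones.\<close>
  have bound: "\<bar>G z\<bar> \<le> (M + 2 * B) * min ((norm z)\<^sup>2) 1" for z
  proof (cases "norm z \<le> 1")
    case True
    then have "(norm z)\<^sup>2 \<le> 1" by (simp add: power_le_one)
    moreover have "\<bar>G z\<bar> \<le> M * (norm z)\<^sup>2" using True M(2)[of x z] by (simp add: G_def)
    moreover have "0 \<le> B * (norm z)\<^sup>2" using B by simp
    ultimately show ?thesis by (simp add: algebra_simps min_def)
  next
    case False
    then have "(norm z)\<^sup>2 \<ge> 1" by (simp add: one_le_power)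
    moreover have "\<bar>G z\<bar> \<le> 2 * B" using False B(2)[of "x + z"] B(2)[of x] by (simp add: G_def)
    ultimately show ?thesis using M(1) by (simp add: min_def)
  qed
  have G: "integrable \<mu> G"
  proof (rule Bochner_Integration.integrable_bound)
    show "integrable \<mu> (\<lambda>z. (M + 2 * B) * min ((norm z)\<^sup>2) 1)"
      using levy_measure_integrable[OF \<mu>] by simp
    show "G \<in> borel_measurable \<mu>" unfolding G_def by measurable
    show "AE z in \<mu>. norm (G z) \<le> norm ((M + 2 * B) * min ((norm z)\<^sup>2) 1)"
      using bound M(1) B(1) by (intro AE_I2) (simp add: abs_mult)
  qed
  have "nonlocal_op \<mu> \<psi> x = (LINT z|\<mu>. G z)"
    unfolding nonlocal_op_def set_lebesgue_integral_def
    by (rule Bochner_Integration.integral_cong) (auto simp: G_def indicator_def)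
  moreover have "2 * (LINT z|\<mu>. G z) = (LINT z|\<mu>. G z + G (- z))"
    using G levy_measure_integral_uminus[OF \<mu> G] by simp
  moreover have "\<dots> = (LINT z|\<mu>. second_diff z \<psi> x)"
    by (rule Bochner_Integration.integral_cong) (auto simp: G_def second_diff_def)
  ultimately show ?thesis by simp
qed

text \<open>Joint integrability, so that the order of the integrals over \<open>x\<close> and
  \<open>z\<close> can be exchanged. The quadratic bound in \<open>z\<close> tames the singularity
  of \<open>\<mu>\<close> at the origin.\<close>

lemma second_diff_integrable:
  fixes \<mu> :: "'a::euclidean_space measure"
  assumes \<mu>: "levy_measure \<mu>" and \<psi>: "test_function \<psi>"
    and c[measurable]: "c \<in> borel_measurable borel" and C: "\<And>x. \<bar>c x\<bar> \<le> C"
  shows "integrable (lborel \<Otimes>\<^sub>M \<mu>) (\<lambda>(x, z). c x * second_diff z \<psi> x)"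
proof -
  have [measurable_cong]: "sets \<mu> = sets borel" using \<mu> by (simp add: levy_measure_def)
  note [measurable] = test_function_measurable[OF \<psi>]
  interpret \<mu>: sigma_finite_measure \<mu> by (rule levy_measure_sigma_finite[OF \<mu>])
  interpret pair_sigma_finite lborel \<mu> ..
  obtain R where R: "\<And>x. R < norm x \<Longrightarrow> \<psi> x = 0"
    using test_function_zero_outside[OF \<psi>] by blast
  obtain M where M: "M \<ge> 0" "\<And>x z. \<bar>second_diff z \<psi> x\<bar> \<le> M * (norm z)\<^sup>2"
    using second_diff_bound[OF \<psi>] by blast
  have C0: "C \<ge> 0" using C[of 0] by simp
  \<comment> \<open>The majorant in \<open>x\<close>. For \<open>norm z \<le> 1\<close> the second
    difference lives in a ball of radius \<open>R + 1\<close>. For larger \<open>z\<close> its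
    support wanders off, so the translates of \<open>\<psi>\<close> themselves serve; translation
    invariance makes the integral of \<open>W z\<close> independent of \<open>z\<close>.\<close>
  define W where "W z x = M * indicator (cball 0 (R + 1)) x + \<bar>\<psi> (x + z)\<bar> + \<bar>\<psi> (x - z)\<bar> + 2 * \<bar>\<psi> x\<bar>" for x z
  have W0: "W z x \<ge> 0" for x z unfolding W_def using M(1) by simp
  have bound: "\<bar>second_diff z \<psi> x\<bar> \<le> min ((norm z)\<^sup>2) 1 * W z x" for x z
  proof (cases "norm z \<le> 1")
    case True
    then have *: "(norm z)\<^sup>2 \<le> 1" by (simp add: power_le_one)
    have "\<bar>second_diff z \<psi> x\<bar> \<le> (norm z)\<^sup>2 * (M * indicator (cball 0 (R + 1)) x)"
    proof (cases "x \<in> cball 0 (R + 1)")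
      case False
      then have "second_diff z \<psi> x = 0"
        using True by (intro second_diff_zero_outside[OF R]) auto
      then show ?thesis by (simp add: M(1))
    qed (use M(2)[of z x] in \<open>simp add: mult.commute\<close>)
    also have "\<dots> \<le> (norm z)\<^sup>2 * W z x"
      unfolding W_def by (intro mult_left_mono) auto
    finally show ?thesis using * by simp
  next
    case False
    then have "(norm z)\<^sup>2 \<ge> 1" by (simp add: one_le_power)
    moreover have "\<bar>second_diff z \<psi> x\<bar> \<le> W z x"
      using mult_nonneg_nonneg[OF M(1), of "indicator (cball 0 (R + 1)) x"]
      unfolding second_diff_def W_def by simp
    ultimately show ?thesis by simp
  qed
  note i\<psi> = test_function_integrable[OF \<psi>]
  note ish = lborel_integrable_shift[OF i\<psi>]
  have iball: "integrable lborel (indicator (cball 0 (R + 1)) :: 'a \<Rightarrow> real)"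
    using emeasure_compact_finite[of "cball (0::'a) (R + 1)"] by (intro integrable_real_indicator) auto
  define K where "K = M * measure lborel (cball (0::'a) (R + 1)) + 4 * (LINT x|lborel. \<bar>\<psi> x\<bar>)"
  have iW: "integrable lborel (W z)" for z
    unfolding W_def using iball i\<psi> ish[of z] ish[of "- z"] by simp
  have "(LINT x|lborel. W z x) = K" for z
    unfolding W_def K_def
    using iball i\<psi> ish[of z] ish[of "- z"] lborel_integral_shift[of "\<lambda>x. \<bar>\<psi> x\<bar>" z]
      lborel_integral_shift[of "\<lambda>x. \<bar>\<psi> x\<bar>" "- z"]
    by simp
  then have nn: "(\<integral>\<^sup>+x. ennreal (norm (c x * second_diff z \<psi> x)) \<partial>lborel) \<le> ennreal (C * K * min ((norm z)\<^sup>2) 1)" for z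
  proof -
    have "(\<integral>\<^sup>+x. ennreal (norm (c x * second_diff z \<psi> x)) \<partial>lborel)
        \<le> (\<integral>\<^sup>+x. ennreal (C * (min ((norm z)\<^sup>2) 1 * W z x)) \<partial>lborel)"
      unfolding real_norm_def abs_mult
      by (intro nn_integral_mono ennreal_leI mult_mono C bound C0) auto
    also have "\<dots> = ennreal (LINT x|lborel. C * (min ((norm z)\<^sup>2) 1 * W z x))"
      by (intro nn_integral_eq_integral) (use iW W0 C0 in auto)
    also have "\<dots> = ennreal (C * K * min ((norm z)\<^sup>2) 1)"
      using \<open>\<And>z. (LINT x|lborel. W z x) = K\<close> by (simp add: mult_ac)
    finally show ?thesis .
  qed
  have meas: "(\<lambda>(x, z). c x * second_diff z \<psi> x) \<in> borel_measurable (lborel \<Otimes>\<^sub>M \<mu>)"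
    unfolding second_diff_def by measurable
  have K0: "K \<ge> 0" unfolding K_def using M(1) by simp
  have "(\<integral>\<^sup>+p. ennreal (norm (case p of (x, z) \<Rightarrow> c x * second_diff z \<psi> x)) \<partial>(lborel \<Otimes>\<^sub>M \<mu>))
      = (\<integral>\<^sup>+z. (\<integral>\<^sup>+x. ennreal (norm (c x * second_diff z \<psi> x)) \<partial>lborel) \<partial>\<mu>)"
    using meas by (subst nn_integral_snd[symmetric]) (auto intro!: measurable_compose[OF _ measurable_ennreal] borel_measurable_norm)
  also have "\<dots> \<le> (\<integral>\<^sup>+z. ennreal (C * K * min ((norm z)\<^sup>2) 1) \<partial>\<mu>)"
    by (intro nn_integral_mono nn)
  also have "\<dots> = ennreal (LINT z|\<mu>. C * K * min ((norm z)\<^sup>2) 1)"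
    using levy_measure_integrable[OF \<mu>] K0 C0 by (intro nn_integral_eq_integral) auto
  also have "\<dots> < \<infinity>" by simp
  finally show ?thesis
    by (intro integrableI_bounded meas)
qed

text \<open>Presents the local part as a limit of second differences, so that local and nonlocal
  parts obey the same inequalities.\<close>

lemma second_diff_quotient_tendsto:
  fixes \<psi> :: "'a::euclidean_space \<Rightarrow> real"
  assumes \<psi>: "test_function \<psi>" and [measurable]: "c \<in> borel_measurable borel" and C: "\<And>x. \<bar>c x\<bar> \<le> C"
  defines "h \<equiv> \<lambda>n. inverse (real (Suc n))"
  shows "(\<lambda>n. (LINT x|lborel. c x * second_diff (h n *\<^sub>R v) \<psi> x) / (h n)\<^sup>2)
    \<longlonglongrightarrow> (LINT x|lborel. c x * dirderiv v (dirderiv v \<psi>) x)"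
proof -
  note [measurable] = test_function_measurable[OF \<psi>]
    test_function_measurable[OF test_function_dirderiv[OF test_function_dirderiv[OF \<psi>]]]
  obtain R where R: "\<And>x. R < norm x \<Longrightarrow> \<psi> x = 0"
    using test_function_zero_outside[OF \<psi>] by blast
  obtain M where M: "M \<ge> 0" "\<And>x z. \<bar>second_diff z \<psi> x\<bar> \<le> M * (norm z)\<^sup>2"
    using second_diff_bound[OF \<psi>] by blast
  have C0: "C \<ge> 0" using C[of 0] by simp
  have h: "0 < h n" "h n \<le> 1" for n
    unfolding h_def by (auto simp: field_simps)
  have h0: "h \<longlonglongrightarrow> 0" unfolding h_def by (rule LIMSEQ_inverse_real_of_nat)
  let ?D = "dirderiv v (dirderiv v \<psi>)"
  \<comment> \<open>Taylor at \<open>h n\<close> and at \<open>- h n\<close>: the first-order terms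
    cancel, leaving the average of two second derivatives at points converging to
    \<open>x\<close>.\<close>
  have quot: "\<exists>s t. \<bar>s\<bar> \<le> h n \<and> \<bar>t\<bar> \<le> h n \<and>
      second_diff (h n *\<^sub>R v) \<psi> x / (h n)\<^sup>2 = (?D (x + s *\<^sub>R v) + ?D (x + t *\<^sub>R v)) / 2" for n x
  proof -
    obtain s where s: "\<bar>s\<bar> \<le> \<bar>h n\<bar>" "\<psi> (x + h n *\<^sub>R v) = \<psi> x + h n * dirderiv v \<psi> x + (h n)\<^sup>2 / 2 * ?D (x + s *\<^sub>R v)"
      using taylor_dirderiv[OF test_function_smooth[OF \<psi>]] by blast
    obtain t where t: "\<bar>t\<bar> \<le> \<bar>- h n\<bar>" "\<psi> (x + (- h n) *\<^sub>R v) = \<psi> x + (- h n) * dirderiv v \<psi> x + (- h n)\<^sup>2 / 2 * ?D (x + t *\<^sub>R v)"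
      using taylor_dirderiv[OF test_function_smooth[OF \<psi>]] by blast
    have "second_diff (h n *\<^sub>R v) \<psi> x = (h n)\<^sup>2 * ((?D (x + s *\<^sub>R v) + ?D (x + t *\<^sub>R v)) / 2)"
      using s(2) t(2) by (simp add: second_diff_def algebra_simps)
    then show ?thesis using s(1) t(1) h[of n] by (intro exI[of _ s] exI[of _ t]) (simp add: field_simps)
  qed
  have lim: "(\<lambda>n. second_diff (h n *\<^sub>R v) \<psi> x / (h n)\<^sup>2) \<longlonglongrightarrow> ?D x" for x
  proof -
    obtain s t where st: "\<And>n. \<bar>s n\<bar> \<le> h n" "\<And>n. \<bar>t n\<bar> \<le> h n"
      "\<And>n. second_diff (h n *\<^sub>R v) \<psi> x / (h n)\<^sup>2 = (?D (x + s n *\<^sub>R v) + ?D (x + t n *\<^sub>R v)) / 2"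
      using quot[of _ x] by metis
    have lim0: "(\<lambda>n. ?D (x + u n *\<^sub>R v)) \<longlonglongrightarrow> ?D x" if "\<And>n. \<bar>u n\<bar> \<le> h n" for u
    proof -
      have "u \<longlonglongrightarrow> 0" by (rule Lim_null_comparison[OF _ h0]) (use that in auto)
      then have "(\<lambda>n. x + u n *\<^sub>R v) \<longlonglongrightarrow> x + 0 *\<^sub>R v" by (intro tendsto_intros)
      moreover have "isCont ?D x"
        using test_function_continuous[OF test_function_dirderiv[OF test_function_dirderiv[OF \<psi>]], of UNIV]
        by (simp add: continuous_on_eq_continuous_at)
      ultimately show ?thesis by (intro isCont_tendsto_compose[of x ?D]) auto
    qed
    show ?thesis
      unfolding st(3) using tendsto_divide[OF tendsto_add[OF lim0[OF st(1)] lim0[OF st(2)]] tendsto_const[of 2]]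
      by simp
  qed
  have "(\<lambda>n. LINT x|lborel. c x * (second_diff (h n *\<^sub>R v) \<psi> x / (h n)\<^sup>2)) \<longlonglongrightarrow> (LINT x|lborel. c x * ?D x)"
  proof (rule integral_dominated_convergence[where w="\<lambda>x. C * (M * (norm v)\<^sup>2) * indicator (cball 0 (R + norm v)) x"])
    have "integrable lborel (indicator (cball 0 (R + norm v)) :: 'a \<Rightarrow> real)"
      using emeasure_compact_finite[of "cball (0::'a) (R + norm v)"] by (intro integrable_real_indicator) auto
    then show "integrable lborel (\<lambda>x::'a. C * (M * (norm v)\<^sup>2) * indicator (cball 0 (R + norm v)) x :: real)"
      by simp
    show "AE x in lborel. (\<lambda>n. c x * (second_diff (h n *\<^sub>R v) \<psi> x / (h n)\<^sup>2)) \<longlonglongrightarrow> c x * ?D x"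
      using lim by (intro AE_I2 tendsto_mult_left)
    show "AE x in lborel. norm (c x * (second_diff (h n *\<^sub>R v) \<psi> x / (h n)\<^sup>2))
        \<le> C * (M * (norm v)\<^sup>2) * indicator (cball 0 (R + norm v)) x" for n
    proof (intro AE_I2)
      fix x
      have hn: "\<bar>h n\<bar> * norm v \<le> norm v" using h[of n] by (simp add: mult_left_le_one_le)
      have "\<bar>second_diff (h n *\<^sub>R v) \<psi> x / (h n)\<^sup>2\<bar> \<le> M * (norm v)\<^sup>2 * indicator (cball 0 (R + norm v)) x"
      proof (cases "x \<in> cball 0 (R + norm v)")
        case True
        have "\<bar>second_diff (h n *\<^sub>R v) \<psi> x\<bar> \<le> M * (norm v)\<^sup>2 * (h n)\<^sup>2"
          using M(2)[of "h n *\<^sub>R v" x] by (simp add: power_mult_distrib mult_ac)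
        then show ?thesis using True h[of n] by (simp add: field_simps)
      next
        case False
        then have "second_diff (h n *\<^sub>R v) \<psi> x = 0"
          using hn by (intro second_diff_zero_outside[OF R]) auto
        then show ?thesis using M(1) by simp
      qed
      then show "norm (c x * (second_diff (h n *\<^sub>R v) \<psi> x / (h n)\<^sup>2))
        \<le> C * (M * (norm v)\<^sup>2) * indicator (cball 0 (R + norm v)) x"
        unfolding real_norm_def abs_mult[of "c x"] mult.assoc[of C]
        by (intro mult_mono C C0) auto
    qed
  qed (auto simp: second_diff_def)
  then show ?thesis
    by simp
qed

text \<open>Fubini brings the integral over \<open>x\<close> inside the one over \<open>z\<close>,
  so that only one direction or one jump has to be considered at a time.\<close>

lemma levy_op_integral:
  fixes \<mu> :: "'a::euclidean_space measure"
  assumes \<mu>: "levy_measure \<mu>" and \<psi>: "test_function \<psi>"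
    and c: "c \<in> borel_measurable borel" and C: "\<And>x. \<bar>c x\<bar> \<le> C"
  shows "integrable lborel (\<lambda>x. c x * levy_op P \<sigma> \<mu> \<psi> x)"
    and "(LINT x|lborel. c x * levy_op P \<sigma> \<mu> \<psi> x) =
      (\<Sum>i<P. LINT x|lborel. c x * dirderiv (\<sigma> i) (dirderiv (\<sigma> i) \<psi>) x)
      + (LINT z|\<mu>. LINT x|lborel. c x * second_diff z \<psi> x) / 2"
proof -
  interpret \<mu>: sigma_finite_measure \<mu> by (rule levy_measure_sigma_finite[OF \<mu>])
  interpret pair_sigma_finite lborel \<mu> ..
  note int = second_diff_integrable[OF \<mu> \<psi> c C]
  have eq: "c x * levy_op P \<sigma> \<mu> \<psi> x = (\<Sum>i<P. c x * dirderiv (\<sigma> i) (dirderiv (\<sigma> i) \<psi>) x)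
      + (LINT z|\<mu>. c x * second_diff z \<psi> x) / 2" for x
    unfolding levy_op_def local_op_def nonlocal_op_eq[OF \<mu> \<psi>] integral_mult_right_zero
    by (simp add: sum_distrib_left algebra_simps)
  have loc: "integrable lborel (\<lambda>x. c x * dirderiv (\<sigma> i) (dirderiv (\<sigma> i) \<psi>) x)" for i
  proof (rule Bochner_Integration.integrable_bound)
    show "integrable lborel (\<lambda>x. C * dirderiv (\<sigma> i) (dirderiv (\<sigma> i) \<psi>) x)"
      using test_function_integrable[OF test_function_dirderiv[OF test_function_dirderiv[OF \<psi>]]] by simp
    show "AE x in lborel. norm (c x * dirderiv (\<sigma> i) (dirderiv (\<sigma> i) \<psi>) x) \<le> norm (C * dirderiv (\<sigma> i) (dirderiv (\<sigma> i) \<psi>) x)"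
        unfolding norm_mult by (intro AE_I2 mult_right_mono) (use C in \<open>auto intro: order_trans[OF _ abs_ge_self]\<close>)
  qed (use c test_function_measurable[OF test_function_dirderiv[OF test_function_dirderiv[OF \<psi>]]] in simp)
  show "integrable lborel (\<lambda>x. c x * levy_op P \<sigma> \<mu> \<psi> x)"
    unfolding eq using loc integrable_fst[OF int] by simp
  show "(LINT x|lborel. c x * levy_op P \<sigma> \<mu> \<psi> x) =
      (\<Sum>i<P. LINT x|lborel. c x * dirderiv (\<sigma> i) (dirderiv (\<sigma> i) \<psi>) x)
      + (LINT z|\<mu>. LINT x|lborel. c x * second_diff z \<psi> x) / 2"
    unfolding eq using loc integrable_fst[OF int] Fubini_integral[OF int] by simp
qed

lemma levy_op_integrable:
  assumes "levy_measure \<mu>" "test_function \<psi>"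
  shows "integrable lborel (levy_op P \<sigma> \<mu> \<psi>)"
  using levy_op_integral(1)[OF assms, of "\<lambda>_. 1" 1] by simp

text \<open>Both parts of the operator are positive combinations or limits of second differences, so
  an inequality valid for each \<open>z\<close> survives. With two pairs instead of one pair and 0,
  it also yields symmetry when used in both directions.\<close>

lemma levy_op_compare:
  fixes \<mu> :: "'a::euclidean_space measure"
  assumes \<mu>: "levy_measure \<mu>" and \<psi>1: "test_function \<psi>1" and \<psi>2: "test_function \<psi>2"
    and c1: "c1 \<in> borel_measurable borel" "\<And>x. \<bar>c1 x\<bar> \<le> C1"
    and c2: "c2 \<in> borel_measurable borel" "\<And>x. \<bar>c2 x\<bar> \<le> C2"
    and le: "\<And>z. (LINT x|lborel. c1 x * second_diff z \<psi>1 x) \<le> (LINT x|lborel. c2 x * second_diff z \<psi>2 x)"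
  shows "(LINT x|lborel. c1 x * levy_op P \<sigma> \<mu> \<psi>1 x) \<le> (LINT x|lborel. c2 x * levy_op P \<sigma> \<mu> \<psi>2 x)"
proof -
  interpret \<mu>: sigma_finite_measure \<mu> by (rule levy_measure_sigma_finite[OF \<mu>])
  interpret pair_sigma_finite lborel \<mu> ..
  have "(LINT x|lborel. c1 x * dirderiv v (dirderiv v \<psi>1) x) \<le> (LINT x|lborel. c2 x * dirderiv v (dirderiv v \<psi>2) x)" for v
    by (rule LIMSEQ_le[OF second_diff_quotient_tendsto[OF \<psi>1 c1] second_diff_quotient_tendsto[OF \<psi>2 c2]])
      (use le in \<open>auto intro!: divide_right_mono\<close>)
  moreover have "(LINT z|\<mu>. LINT x|lborel. c1 x * second_diff z \<psi>1 x) \<le> (LINT z|\<mu>. LINT x|lborel. c2 x * second_diff z \<psi>2 x)"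
    by (intro integral_mono le integrable_snd second_diff_integrable[OF \<mu> \<psi>1 c1] second_diff_integrable[OF \<mu> \<psi>2 c2])
  ultimately show ?thesis
    unfolding levy_op_integral(2)[OF \<mu> \<psi>1 c1] levy_op_integral(2)[OF \<mu> \<psi>2 c2]
    by (intro add_mono sum_mono divide_right_mono) auto
qed

lemma levy_op_shift:
  assumes "test_function \<psi>"
  shows "levy_op P \<sigma> \<mu> (\<lambda>x. \<psi> (x + a)) x = levy_op P \<sigma> \<mu> \<psi> (x + a)"
proof -
  have s: "smooth \<psi>" by (rule test_function_smooth[OF assms])
  have 1: "dirderiv v (\<lambda>x. \<psi> (x + a)) = (\<lambda>x. dirderiv v \<psi> (x + a))" for v
    by (rule dirderiv_shift[OF smooth_differentiable[OF s]])
  have 2: "dirderiv v (\<lambda>x. dirderiv v \<psi> (x + a)) = (\<lambda>x. dirderiv v (dirderiv v \<psi>) (x + a))" for v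
    by (rule dirderiv_shift[OF smooth_differentiable[OF smooth_dirderiv[OF s]]])
  show ?thesis
    unfolding levy_op_def local_op_def nonlocal_op_def grad_def 1 2
    by (simp add: add.assoc add.commute[of a])
qed

section \<open>Correlation with a kernel\<close>

lemma integrable_bounded_mult:
  fixes f g :: "'a::euclidean_space \<Rightarrow> real"
  assumes "g \<in> borel_measurable borel" "\<And>x. \<bar>g x\<bar> \<le> C" "integrable lborel f"
  shows "integrable lborel (\<lambda>x. g x * f x)"
proof (rule Bochner_Integration.integrable_bound)
  show "integrable lborel (\<lambda>x. C * f x)" using assms(3) by simp
  show "AE x in lborel. norm (g x * f x) \<le> norm (C * f x)"
    unfolding norm_mult
    by (intro AE_I2 mult_right_mono) (use assms(2) in \<open>auto intro: order_trans[OF _ abs_ge_self]\<close>)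
qed (use assms(1) borel_measurable_integrable[OF assms(3)] in simp)

text \<open>Convolution with the reflected kernel. With this sign the double integral of
  \<open>g x * f (x + s) * \<rho> s\<close> is symmetric in \<open>g\<close> and
  \<open>\<rho>\<close>, so they are exchanged without reflections.\<close>

definition corr :: "('a::euclidean_space \<Rightarrow> real) \<Rightarrow> ('a \<Rightarrow> real) \<Rightarrow> 'a \<Rightarrow> real" where
  "corr f \<rho> x = (LINT s|lborel. f (x + s) * \<rho> s)"

lemma corr_measurable:
  assumes [measurable]: "f \<in> borel_measurable borel" "\<rho> \<in> borel_measurable borel"
  shows "corr f \<rho> \<in> borel_measurable borel"
  unfolding corr_def by measurable

lemma corr_integrable:
  fixes C :: real
  assumes "f \<in> borel_measurable borel" "\<And>x. \<bar>f x\<bar> \<le> C" "integrable lborel \<rho>"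
  shows "integrable lborel (\<lambda>s. f (x + s) * \<rho> s)"
  using assms by (intro integrable_bounded_mult[of _ C]) auto

lemma corr_bounded:
  assumes "f \<in> borel_measurable borel" "\<And>x. \<bar>f x\<bar> \<le> C" "integrable lborel \<rho>"
  shows "\<bar>corr f \<rho> x\<bar> \<le> C * (LINT s|lborel. \<bar>\<rho> s\<bar>)"
proof -
  have "\<bar>corr f \<rho> x\<bar> \<le> (LINT s|lborel. \<bar>f (x + s) * \<rho> s\<bar>)"
    unfolding corr_def by (rule integral_abs_bound)
  also have "\<dots> \<le> (LINT s|lborel. C * \<bar>\<rho> s\<bar>)"
    using integrable_abs[OF corr_integrable[OF assms, of x]] assms(3)
    by (intro integral_mono) (auto simp: abs_mult intro!: mult_right_mono assms(2))
  finally show ?thesis by simp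
qed

lemma corr_shift_left:
  assumes [measurable]: "f \<in> borel_measurable borel" "\<rho> \<in> borel_measurable borel"
  shows "corr f \<rho> x = (LINT y|lborel. f y * \<rho> (y - x))"
  unfolding corr_def using lborel_integral_shift[of "\<lambda>y. f y * \<rho> (y - x)" x] by (simp add: add.commute)

lemma corr_shift_right:
  assumes [measurable]: "f \<in> borel_measurable borel" "\<rho> \<in> borel_measurable borel"
  shows "corr f (\<lambda>s. \<rho> (s + a)) x = corr f \<rho> (x - a)"
  unfolding corr_def using lborel_integral_shift[of "\<lambda>s. f (x - a + s) * \<rho> s" a] by (simp add: algebra_simps)

text \<open>Fubini for \<open>g x * f (x + s) * \<rho> s\<close>, dominated by a multiple of
  \<open>g x * \<rho> s\<close> because the middle factor is bounded.\<close>

lemma corr_swap: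
  fixes f g \<rho> :: "'a::euclidean_space \<Rightarrow> real"
  assumes f[measurable]: "f \<in> borel_measurable borel" and C: "\<And>x. \<bar>f x\<bar> \<le> C"
    and g: "integrable lborel g" and \<rho>: "integrable lborel \<rho>"
  shows "(LINT x|lborel. g x * corr f \<rho> x) = (LINT s|lborel. \<rho> s * corr f g s)"
proof -
  have [measurable]: "g \<in> borel_measurable borel" "\<rho> \<in> borel_measurable borel"
    using g \<rho> by (auto dest: borel_measurable_integrable)
  have gr: "integrable (lborel \<Otimes>\<^sub>M lborel) (\<lambda>(x, s). g x * \<rho> s)"
    by (rule lborel_pair.Fubini_integrable) (use g \<rho> in \<open>auto simp: abs_mult\<close>)
  have "integrable (lborel \<Otimes>\<^sub>M lborel) (\<lambda>(x, s). g x * (f (x + s) * \<rho> s))"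
  proof (rule Bochner_Integration.integrable_bound)
    show "integrable (lborel \<Otimes>\<^sub>M lborel) (\<lambda>p. C * (case p of (x, s) \<Rightarrow> g x * \<rho> s))"
      using gr by simp
    show "AE p in lborel \<Otimes>\<^sub>M lborel. norm (case p of (x, s) \<Rightarrow> g x * (f (x + s) * \<rho> s)) \<le> norm (C * (case p of (x, s) \<Rightarrow> g x * \<rho> s))"
    proof (intro AE_I2)
      fix p :: "'a \<times> 'a"
      obtain x s where p: "p = (x, s)" by fastforce
      have "\<bar>f (x + s)\<bar> * (\<bar>g x\<bar> * \<bar>\<rho> s\<bar>) \<le> \<bar>C\<bar> * (\<bar>g x\<bar> * \<bar>\<rho> s\<bar>)"
        by (intro mult_right_mono order_trans[OF C abs_ge_self]) auto
      then show "norm (case p of (x, s) \<Rightarrow> g x * (f (x + s) * \<rho> s)) \<le> norm (C * (case p of (x, s) \<Rightarrow> g x * \<rho> s))"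
        unfolding p by (simp add: abs_mult mult_ac)
    qed
  qed measurable
  from lborel_pair.Fubini_integral[OF this]
  have "(LINT x|lborel. g x * corr f \<rho> x) = (LINT s|lborel. LINT x|lborel. g x * (f (x + s) * \<rho> s))"
    by (simp add: corr_def)
  also have "\<dots> = (LINT s|lborel. \<rho> s * corr f g s)"
    unfolding corr_def integral_mult_right_zero[symmetric]
    by (intro Bochner_Integration.integral_cong) (auto simp: mult_ac add.commute)
  finally show ?thesis .
qed

text \<open>Companion of \<open>corr_swap\<close> with an integrable middle factor and a bounded
  \<open>g\<close>. The majorant is a multiple of \<open>\<rho> s * k (x + s)\<close>, integrable
  since translation preserves the norm of \<open>k\<close>.\<close>

lemma corr_swap_integrable:
  fixes k g \<rho> :: "'a::euclidean_space \<Rightarrow> real"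
  assumes g[measurable]: "g \<in> borel_measurable borel" and C: "\<And>x. \<bar>g x\<bar> \<le> C"
    and k: "integrable lborel k" and \<rho>: "integrable lborel \<rho>"
  shows "integrable lborel (\<lambda>x. g x * corr k \<rho> x)"
    and "(LINT x|lborel. g x * corr k \<rho> x) = (LINT s|lborel. \<rho> s * corr k g s)"
proof -
  have [measurable]: "k \<in> borel_measurable borel" "\<rho> \<in> borel_measurable borel"
    using k \<rho> by (auto dest: borel_measurable_integrable)
  have kr: "integrable (lborel \<Otimes>\<^sub>M lborel) (\<lambda>(s, x). \<rho> s * k (x + s))"
  proof (rule lborel_pair.Fubini_integrable)
    have "(LINT x|lborel. \<bar>k (x + s)\<bar>) = (LINT x|lborel. \<bar>k x\<bar>)" for s
      by (rule lborel_integral_shift[of "\<lambda>x. \<bar>k x\<bar>"]) measurable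
    then show "integrable lborel (\<lambda>s. LINT x|lborel. norm (case (s, x) of (s, x) \<Rightarrow> \<rho> s * k (x + s)))"
      using \<rho> by (simp add: abs_mult)
  qed (use lborel_integrable_shift[OF k] in auto)
  have "integrable (lborel \<Otimes>\<^sub>M lborel) (\<lambda>(s, x). g x * (k (x + s) * \<rho> s))"
  proof (rule Bochner_Integration.integrable_bound)
    show "integrable (lborel \<Otimes>\<^sub>M lborel) (\<lambda>p. C * (case p of (s, x) \<Rightarrow> \<rho> s * k (x + s)))"
      using kr by simp
    show "AE p in lborel \<Otimes>\<^sub>M lborel. norm (case p of (s, x) \<Rightarrow> g x * (k (x + s) * \<rho> s)) \<le> norm (C * (case p of (s, x) \<Rightarrow> \<rho> s * k (x + s)))"
    proof (intro AE_I2)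
      fix p :: "'a \<times> 'a"
      obtain s x where p: "p = (s, x)" by fastforce
      have "\<bar>g x\<bar> * (\<bar>k (x + s)\<bar> * \<bar>\<rho> s\<bar>) \<le> \<bar>C\<bar> * (\<bar>k (x + s)\<bar> * \<bar>\<rho> s\<bar>)"
        by (intro mult_right_mono order_trans[OF C abs_ge_self]) auto
      then show "norm (case p of (s, x) \<Rightarrow> g x * (k (x + s) * \<rho> s)) \<le> norm (C * (case p of (s, x) \<Rightarrow> \<rho> s * k (x + s)))"
        unfolding p by (simp add: abs_mult mult_ac)
    qed
  qed measurable
  note int = this
  show "integrable lborel (\<lambda>x. g x * corr k \<rho> x)"
    using lborel_pair.integrable_snd[OF int] by (simp add: corr_def)
  have "(LINT x|lborel. g x * corr k \<rho> x) = (LINT s|lborel. LINT x|lborel. g x * (k (x + s) * \<rho> s))"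
    using lborel_pair.Fubini_integral[OF int] by (simp add: corr_def)
  also have "\<dots> = (LINT s|lborel. \<rho> s * corr k g s)"
    unfolding corr_def integral_mult_right_zero[symmetric]
    by (intro Bochner_Integration.integral_cong) (auto simp: mult_ac add.commute)
  finally show "(LINT x|lborel. g x * corr k \<rho> x) = (LINT s|lborel. \<rho> s * corr k g s)" .
qed

lemma corr_integrable_L1:
  fixes k \<rho> :: "'a::euclidean_space \<Rightarrow> real"
  assumes "integrable lborel k" "integrable lborel \<rho>"
  shows "integrable lborel (corr k \<rho>)"
  using corr_swap_integrable(1)[of "\<lambda>_. 1" 1, OF _ _ assms] by simp

lemma integral_bump_ge:
  fixes \<rho> F :: "'a::euclidean_space \<Rightarrow> real"
  assumes "integrable lborel \<rho>" "\<And>x. \<rho> x \<ge> 0" "\<And>x. r \<le> norm x \<Longrightarrow> \<rho> x = 0"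
    and "integrable lborel (\<lambda>s. \<rho> s * F s)" "\<And>s. norm s < r \<Longrightarrow> m \<le> F s"
  shows "m * (LINT s|lborel. \<rho> s) \<le> (LINT s|lborel. \<rho> s * F s)"
proof -
  have "\<rho> s * m \<le> \<rho> s * F s" for s
    using assms(2,3,5)[of s] by (cases "norm s < r") (auto intro: mult_left_mono)
  then have "(LINT s|lborel. \<rho> s * m) \<le> (LINT s|lborel. \<rho> s * F s)"
    using assms(1,4) by (intro integral_mono) auto
  then show ?thesis by (simp add: mult.commute)
qed

text \<open>Testing with translates of \<open>\<rho>\<close> gives \<open>corr w \<rho> = 0\<close>.
  Pairing this with \<open>sgn (w x)\<close> and swapping shows that the
  \<open>\<rho>\<close>-weighted integral over \<open>s\<close> of the pairings of
  \<open>sgn (w x)\<close> with \<open>w (x + s)\<close> is 0, yet for small \<open>s\<close> each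
  pairing is at least half the L1 norm of \<open>w\<close>.\<close>

lemma test_function_separating:
  fixes w :: "'a::euclidean_space \<Rightarrow> real"
  assumes w: "integrable lborel w" and zero: "\<And>\<psi>. test_function \<psi> \<Longrightarrow> (LINT x|lborel. w x * \<psi> x) = 0"
  shows "AE x in lborel. w x = 0"
proof -
  have [measurable]: "w \<in> borel_measurable borel"
    using w by (auto dest: borel_measurable_integrable)
  define J where "J = (LINT x|lborel. \<bar>w x\<bar>)"
  have "J = 0"
  proof (rule ccontr)
    assume "J \<noteq> 0"
    moreover have "J \<ge> 0" unfolding J_def by simp
    ultimately have J: "J > 0" by simp
    then obtain d where d: "d > 0" "\<And>a. norm a < d \<Longrightarrow> (LINT x|lborel. \<bar>w (x + a) - w x\<bar>) < J / 2"
      using L1_continuousE[OF w, of "J / 2"] by auto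
    obtain \<rho> :: "'a \<Rightarrow> real" where \<rho>: "test_function \<rho>" "\<And>x. \<rho> x \<ge> 0" "\<And>x. d \<le> norm x \<Longrightarrow> \<rho> x = 0" "(LINT x|lborel. \<rho> x) > 0"
      using bump_exists[OF d(1)] by blast
    note [measurable] = test_function_measurable[OF \<rho>(1)]
    note i\<rho> = test_function_integrable[OF \<rho>(1)]
    have wsgn: "w x * sgn (w x) = \<bar>w x\<bar>" for x by (simp add: abs_sgn)
    have sgn1: "\<bar>sgn (w x)\<bar> \<le> 1" for x by (simp add: sgn_if)
    have "corr w \<rho> x = 0" for x
      using zero[OF test_function_shift[OF \<rho>(1), of "- x"]] by (subst corr_shift_left) auto
    then have "(LINT s|lborel. \<rho> s * corr w (\<lambda>x. sgn (w x)) s) = 0"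
      using corr_swap_integrable(2)[of "\<lambda>x. sgn (w x)" 1, OF _ sgn1 w i\<rho>] by simp
    moreover have "J / 2 * (LINT s|lborel. \<rho> s) \<le> (LINT s|lborel. \<rho> s * corr w (\<lambda>x. sgn (w x)) s)"
    proof (rule integral_bump_ge[OF i\<rho> \<rho>(2,3)])
      have eq: "corr w (\<lambda>x. sgn (w x)) s = (LINT x|lborel. sgn (w x) * w (x + s))" for s
        unfolding corr_def by (simp add: add.commute mult.commute)
      have "\<bar>LINT x|lborel. sgn (w x) * w (x + s)\<bar> \<le> J" for s
      proof -
        have "\<bar>LINT x|lborel. sgn (w x) * w (x + s)\<bar> \<le> (LINT x|lborel. \<bar>sgn (w x) * w (x + s)\<bar>)"
          by (rule integral_abs_bound)
        also have "\<dots> \<le> (LINT x|lborel. \<bar>w (x + s)\<bar>)"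
          using lborel_integrable_shift[OF w, of s] sgn1
          by (intro integral_mono integrable_abs integrable_bounded_mult[of _ 1])
            (auto simp: abs_mult sgn_if)
        also have "\<dots> = J" unfolding J_def by (rule lborel_integral_shift[of "\<lambda>x. \<bar>w x\<bar>"]) measurable
        finally show ?thesis .
      qed
      then have "integrable lborel (\<lambda>s. corr w (\<lambda>x. sgn (w x)) s * \<rho> s)"
        by (intro integrable_bounded_mult[of _ J] corr_measurable i\<rho>) (auto simp: eq)
      then show "integrable lborel (\<lambda>s. \<rho> s * corr w (\<lambda>x. sgn (w x)) s)"
        by (simp add: mult.commute)
      fix s :: 'a assume s: "norm s < d"
      have ii: "integrable lborel (\<lambda>x. sgn (w x) * w (x + s))"
        using lborel_integrable_shift[OF w, of s] sgn1 by (intro integrable_bounded_mult[of _ 1]) auto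
      have "J - (LINT x|lborel. \<bar>w (x + s) - w x\<bar>) = (LINT x|lborel. \<bar>w x\<bar> - \<bar>w (x + s) - w x\<bar>)"
        unfolding J_def using w lborel_integrable_shift[OF w, of s] by simp
      also have "\<dots> \<le> (LINT x|lborel. sgn (w x) * w (x + s))"
        using w lborel_integrable_shift[OF w, of s] ii
        by (intro integral_mono) (auto simp: sgn_if)
      finally show "J / 2 \<le> corr w (\<lambda>x. sgn (w x)) s"
        using d(2)[OF s] unfolding eq by simp
    qed
    ultimately show False using J \<rho>(4) by (simp add: mult_le_0_iff)
  qed
  then have "AE x in lborel. \<bar>w x\<bar> = 0"
    unfolding J_def using w by (subst (asm) integral_nonneg_eq_0_iff_AE) auto
  then show ?thesis by simp
qed

section \<open>The energy inequality\<close>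

definition soft_threshold :: "real \<Rightarrow> real \<Rightarrow> real" where
  "soft_threshold \<delta> t = t - max (- \<delta>) (min \<delta> t)"

lemma soft_threshold_mono: "s \<le> t \<Longrightarrow> soft_threshold \<delta> s \<le> soft_threshold \<delta> t"
  by (auto simp: soft_threshold_def max_def min_def)

lemma soft_threshold_diff: "\<delta> \<ge> 0 \<Longrightarrow> \<bar>t - soft_threshold \<delta> t\<bar> \<le> \<delta>"
  by (auto simp: soft_threshold_def max_def min_def)

text \<open>Thresholding removes the constant from a bound \<open>\<delta> + b\<close> and keeps the
  integrable part; this makes the threshold of the mollified \<open>\<Phi>\<close>
  integrable.\<close>

lemma soft_threshold_le: "\<bar>t\<bar> \<le> \<delta> + b \<Longrightarrow> b \<ge> 0 \<Longrightarrow> \<delta> \<ge> 0 \<Longrightarrow> \<bar>soft_threshold \<delta> t\<bar> \<le> b"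
  by (auto simp: soft_threshold_def max_def min_def)

text \<open>Discrete integration by parts: translating the \<open>- z\<close> half by
  \<open>z\<close> leaves minus the integral of
  \<open>(v (x + z) - v x) * (j (v (x + z)) - j (v x))\<close>, whose factors have equal sign.
  Integrability of \<open>j (v x)\<close> allows the halves to be split.\<close>

lemma integral_mono_second_diff:
  fixes v :: "'a::euclidean_space \<Rightarrow> real"
  assumes v: "v \<in> borel_measurable borel" "\<And>x. \<bar>v x\<bar> \<le> C"
    and j: "mono j" and g: "integrable lborel (\<lambda>x. j (v x))"
  shows "(LINT x|lborel. j (v x) * (v (x - z) + v (x + z) - 2 * v x)) \<le> 0"
proof -
  note [measurable] = v(1)
  define g' where "g' x = j (v x)" for x
  have g': "integrable lborel g'" using g by (simp add: g'_def[abs_def])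
  have [measurable]: "g' \<in> borel_measurable borel" using g' by (auto dest: borel_measurable_integrable)
  have bd: "\<bar>v (x + a) - v (x + b)\<bar> \<le> 2 * C" for x a b
    using v(2)[of "x + a"] v(2)[of "x + b"] by simp
  have i1: "integrable lborel (\<lambda>x. (v (x + z) - v (x + 0)) * g' x)"
    by (rule integrable_bounded_mult[OF _ bd g']) measurable
  have i2: "integrable lborel (\<lambda>x. (v (x + (- z)) - v (x + 0)) * g' x)"
    by (rule integrable_bounded_mult[OF _ bd g']) measurable
  have i3: "integrable lborel (\<lambda>x. (v (x + 0) - v (x + z)) * g' (x + z))"
    by (rule integrable_bounded_mult[OF _ bd lborel_integrable_shift[OF g']]) measurable
  have "(LINT x|lborel. (v (x + (- z)) - v (x + 0)) * g' x) = (LINT x|lborel. (v (x + 0) - v (x + z)) * g' (x + z))"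
    using lborel_integral_shift[of "\<lambda>x. (v (x + (- z)) - v (x + 0)) * g' x" z] by simp
  moreover have "(LINT x|lborel. g' x * (v (x - z) + v (x + z) - 2 * v x))
      = (LINT x|lborel. (v (x + z) - v (x + 0)) * g' x) + (LINT x|lborel. (v (x + (- z)) - v (x + 0)) * g' x)"
    by (subst Bochner_Integration.integral_add[OF i1 i2, symmetric])
      (auto intro!: Bochner_Integration.integral_cong simp: algebra_simps)
  moreover have "(LINT x|lborel. (v (x + z) - v (x + 0)) * g' x) + (LINT x|lborel. (v (x + 0) - v (x + z)) * g' (x + z))
      = (LINT x|lborel. - ((v (x + z) - v x) * (j (v (x + z)) - j (v x))))"
    by (subst Bochner_Integration.integral_add[OF i1 i3, symmetric])
      (auto intro!: Bochner_Integration.integral_cong simp: algebra_simps g'_def)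
  moreover have "\<dots> \<le> 0"
  proof -
    have "0 \<le> (v (x + z) - v x) * (j (v (x + z)) - j (v x))" for x
      using monoD[OF j, of "v x" "v (x + z)"] monoD[OF j, of "v (x + z)" "v x"]
      by (cases "v x \<le> v (x + z)") (auto simp: mult_nonneg_nonneg mult_nonpos_nonpos)
    then show ?thesis by (simp add: integral_nonneg_AE)
  qed
  ultimately show ?thesis by (simp add: g'_def)
qed

text \<open>Only the linear relation between \<open>\<Phi>\<close> and \<open>w\<close> is recorded,
  without \<open>\<phi>\<close>, so that both the pair from two solutions and the perturbed pair are
  instances. The sign of \<open>\<Phi> w\<close> stays outside because the perturbation need not
  preserve it. \<open>\<Phi>_decay\<close> is an integral form of decay at infinity.\<close>

locale weak_equation =
  fixes P :: nat and \<sigma> :: "nat \<Rightarrow> 'a::euclidean_space" and \<mu> :: "'a measure"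
    and \<Phi> w :: "'a \<Rightarrow> real" and C :: real
  assumes levy: "levy_measure \<mu>"
    and \<Phi>_measurable[measurable]: "\<Phi> \<in> borel_measurable borel" and \<Phi>_bounded: "\<And>x. \<bar>\<Phi> x\<bar> \<le> C"
    and \<Phi>_decay: "\<And>\<delta>. \<delta> > 0 \<Longrightarrow> \<exists>b. integrable lborel b \<and> (\<forall>x. \<bar>\<Phi> x\<bar> \<le> \<delta> + b x)"
    and w_integrable: "integrable lborel w"
    and weak: "\<And>\<eta>. test_function \<eta> \<Longrightarrow>
      (LINT x|lborel. w x * \<eta> x) = (LINT x|lborel. \<Phi> x * levy_op P \<sigma> \<mu> \<eta> x)"
begin

lemma w_measurable[measurable]: "w \<in> borel_measurable borel"
  using w_integrable by (auto dest: borel_measurable_integrable)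

text \<open>Testing with the translate of \<open>\<rho>\<close> by \<open>- x\<close> turns the weak
  equation into a pointwise identity, and the operator commutes with that translation.\<close>

lemma corr_levy_op:
  assumes \<rho>: "test_function \<rho>"
  shows "corr w \<rho> x = corr \<Phi> (levy_op P \<sigma> \<mu> \<rho>) x"
proof -
  have [measurable]: "levy_op P \<sigma> \<mu> \<rho> \<in> borel_measurable borel"
    using levy_op_integrable[OF levy \<rho>] by (auto dest: borel_measurable_integrable)
  have "corr w \<rho> x = (LINT y|lborel. w y * \<rho> (y + (- x)))"
    using test_function_measurable[OF \<rho>] by (subst corr_shift_left) auto
  also have "\<dots> = (LINT y|lborel. \<Phi> y * levy_op P \<sigma> \<mu> \<rho> (y + (- x)))"
    unfolding weak[OF test_function_shift[OF \<rho>]] levy_op_shift[OF \<rho>] ..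
  also have "\<dots> = corr \<Phi> (levy_op P \<sigma> \<mu> \<rho>) x"
    by (subst corr_shift_left) auto
  finally show ?thesis .
qed

text \<open>Pairing \<open>u\<close> with the threshold \<open>g\<close> of \<open>v\<close> and
  swapping gives the integral of \<open>c * L\<close> with \<open>c = corr \<Phi> g\<close>.
  Swapping back for each second difference of \<open>\<rho>\<close> produces a second difference of
  \<open>v\<close> paired with a monotone function of \<open>v\<close>.\<close>

lemma mollified_energy_nonpos:
  assumes \<rho>: "test_function \<rho>"
  shows "(LINT x|lborel. corr \<Phi> \<rho> x * corr w \<rho> x) \<le> 0"
proof (rule field_le_epsilon)
  fix e :: real assume e: "e > 0"
  note [measurable] = test_function_measurable[OF \<rho>]
  note i\<rho> = test_function_integrable[OF \<rho>]
  define v where "v = corr \<Phi> \<rho>"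
  define u where "u = corr w \<rho>"
  define L where "L = levy_op P \<sigma> \<mu> \<rho>"
  have iL: "integrable lborel L" unfolding L_def by (rule levy_op_integrable[OF levy \<rho>])
  have [measurable]: "v \<in> borel_measurable borel" unfolding v_def by (intro corr_measurable) measurable
  define V where "V = C * (LINT s|lborel. \<bar>\<rho> s\<bar>)"
  have V: "\<bar>v x\<bar> \<le> V" for x unfolding v_def V_def by (intro corr_bounded i\<rho> \<Phi>_bounded) measurable
  have iu: "integrable lborel u" unfolding u_def by (intro corr_integrable_L1 i\<rho> w_integrable)
  \<comment> \<open>Replacing \<open>v\<close> by \<open>g\<close> costs at most
    \<open>\<delta>\<close> times the L1 norm of \<open>u\<close>, here at most \<open>e\<close>;
    the \<open>+ 1\<close> guards against a zero norm.\<close>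
  define \<delta> where "\<delta> = e / ((LINT x|lborel. \<bar>u x\<bar>) + 1)"
  have "(LINT x|lborel. \<bar>u x\<bar>) \<ge> 0" by simp
  then have \<delta>: "\<delta> > 0" "\<delta> * (LINT x|lborel. \<bar>u x\<bar>) \<le> e"
    unfolding \<delta>_def using e by (auto simp: field_simps add_pos_nonneg)
  define I where "I = (LINT s|lborel. \<bar>\<rho> s\<bar>)"
  have I: "I \<ge> 0" unfolding I_def by simp
  \<comment> \<open>Correlation with \<open>\<rho>\<close> multiplies constants by up to
    \<open>I\<close>, so the level is scaled down beforehand; then
    \<open>\<bar>v x\<bar> \<le> \<delta> + B x\<close>.\<close>
  obtain b where b: "integrable lborel b" "\<And>x. \<bar>\<Phi> x\<bar> \<le> \<delta> / (I + 1) + b x"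
    using \<Phi>_decay[of "\<delta> / (I + 1)"] \<delta> I by auto
  have [measurable]: "b \<in> borel_measurable borel" using b(1) by (auto dest: borel_measurable_integrable)
  define B where "B = corr (\<lambda>x. \<bar>b x\<bar>) (\<lambda>x. \<bar>\<rho> x\<bar>)"
  have iB: "integrable lborel B" unfolding B_def using b(1) i\<rho> by (intro corr_integrable_L1) auto
  have B0: "B x \<ge> 0" for x unfolding B_def corr_def by simp
  define g where "g x = soft_threshold \<delta> (v x)" for x
  have [measurable]: "g \<in> borel_measurable borel" unfolding g_def[abs_def] soft_threshold_def by measurable
  have gB: "\<bar>g x\<bar> \<le> B x" for x
  proof -
    obtain Mr where Mr: "\<And>x. \<bar>\<rho> x\<bar> \<le> Mr" using test_function_bounded[OF \<rho>] by blast
    have ib: "integrable lborel (\<lambda>s. \<bar>b (x + s)\<bar> * \<bar>\<rho> s\<bar>)"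
      using integrable_bounded_mult[of "\<lambda>s. \<bar>\<rho> s\<bar>" Mr "\<lambda>s. \<bar>b (s + x)\<bar>"] Mr lborel_integrable_shift[OF b(1), of x]
      by (auto simp: mult.commute add.commute)
    have "\<bar>v x\<bar> \<le> (LINT s|lborel. \<bar>\<Phi> (x + s) * \<rho> s\<bar>)"
      unfolding v_def corr_def by (rule integral_abs_bound)
    also have "\<dots> \<le> (LINT s|lborel. \<delta> / (I + 1) * \<bar>\<rho> s\<bar> + \<bar>b (x + s)\<bar> * \<bar>\<rho> s\<bar>)"
    proof (rule integral_mono)
      show "integrable lborel (\<lambda>s. \<bar>\<Phi> (x + s) * \<rho> s\<bar>)"
        by (intro integrable_abs corr_integrable[OF _ \<Phi>_bounded] i\<rho>) measurable
      show "integrable lborel (\<lambda>s. \<delta> / (I + 1) * \<bar>\<rho> s\<bar> + \<bar>b (x + s)\<bar> * \<bar>\<rho> s\<bar>)"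
        using i\<rho> ib by simp
      fix s
      have "\<bar>\<Phi> (x + s)\<bar> \<le> \<delta> / (I + 1) + \<bar>b (x + s)\<bar>" using b(2)[of "x + s"] by linarith
      from mult_right_mono[OF this abs_ge_zero[of "\<rho> s"]]
      show "\<bar>\<Phi> (x + s) * \<rho> s\<bar> \<le> \<delta> / (I + 1) * \<bar>\<rho> s\<bar> + \<bar>b (x + s)\<bar> * \<bar>\<rho> s\<bar>"
        by (simp add: abs_mult distrib_right)
    qed
    also have "\<dots> = \<delta> / (I + 1) * I + B x"
      using i\<rho> ib by (simp add: I_def B_def corr_def)
    also have "\<dots> \<le> \<delta> + B x"
      using I \<delta>(1) by (simp add: field_simps)
    finally show ?thesis
      unfolding g_def using B0 \<delta>(1) by (intro soft_threshold_le) auto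
  qed
  have ig: "integrable lborel g"
    by (rule Bochner_Integration.integrable_bound[OF iB]) (use gB in \<open>auto intro: order_trans[OF _ abs_ge_self]\<close>)
  define c where "c = corr \<Phi> g"
  have c: "c \<in> borel_measurable borel" "\<And>x. \<bar>c x\<bar> \<le> C * (LINT s|lborel. \<bar>g s\<bar>)"
    unfolding c_def by (intro corr_measurable corr_bounded ig \<Phi>_bounded; measurable)+
  have "(LINT s|lborel. c s * second_diff z \<rho> s) \<le> 0" for z
  proof -
    have i1: "integrable lborel (\<lambda>s. \<rho> (s + a))" for a by (rule lborel_integrable_shift[OF i\<rho>])
    have isd: "integrable lborel (second_diff z \<rho>)"
      unfolding second_diff_def[abs_def] using i1[of z] i1[of "- z"] i\<rho> by simp
    have ic: "integrable lborel (\<lambda>s. \<Phi> (x + s) * \<rho> (s + a))" for x a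
      by (intro corr_integrable[OF _ \<Phi>_bounded] i1) measurable
    have "corr \<Phi> (second_diff z \<rho>) x = v (x - z) + v (x + z) - 2 * v x" for x
    proof -
      have "corr \<Phi> (second_diff z \<rho>) x = (LINT s|lborel. \<Phi> (x + s) * \<rho> (s + z) + \<Phi> (x + s) * \<rho> (s + (- z)) - 2 * (\<Phi> (x + s) * \<rho> (s + 0)))"
        unfolding corr_def second_diff_def by (intro Bochner_Integration.integral_cong) (auto simp: algebra_simps)
      also have "\<dots> = corr \<Phi> (\<lambda>s. \<rho> (s + z)) x + corr \<Phi> (\<lambda>s. \<rho> (s + (- z))) x - 2 * corr \<Phi> (\<lambda>s. \<rho> (s + 0)) x"
        using ic[of x z] ic[of x "- z"] ic[of x 0] by (simp add: corr_def)
      also have "\<dots> = v (x - z) + v (x + z) - 2 * v x"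
        unfolding v_def by (subst (1 2 3) corr_shift_right) auto
      finally show ?thesis .
    qed
    then have "(LINT x|lborel. g x * corr \<Phi> (second_diff z \<rho>) x) \<le> 0"
      using integral_mono_second_diff[of v V "soft_threshold \<delta>" z] V ig
      by (simp add: g_def[abs_def] monoI[OF soft_threshold_mono])
    then show ?thesis
      using corr_swap[OF \<Phi>_measurable \<Phi>_bounded ig isd] by (simp add: c_def mult.commute)
  qed
  \<comment> \<open>Comparison with the zero coefficient passes the sign from second differences to
    the operator.\<close>
  then have "(LINT s|lborel. c s * L s) \<le> (LINT s|lborel. (0::real) * L s)"
    unfolding L_def by (intro levy_op_compare[OF levy \<rho> \<rho> c, where ?C2.0=0]) auto
  then have "(LINT s|lborel. L s * corr \<Phi> g s) \<le> 0"
    by (simp add: c_def mult.commute)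
  then have gu: "(LINT x|lborel. g x * u x) \<le> 0"
    using corr_swap[OF \<Phi>_measurable \<Phi>_bounded ig iL] corr_levy_op[OF \<rho>]
    by (simp add: u_def L_def)
  have ivu: "integrable lborel (\<lambda>x. v x * u x)" by (intro integrable_bounded_mult[OF _ V iu]) measurable
  have vg: "\<bar>v x - g x\<bar> \<le> \<delta>" for x using soft_threshold_diff[of \<delta> "v x"] \<delta>(1) by (simp add: g_def)
  have ivgu: "integrable lborel (\<lambda>x. (v x - g x) * u x)"
    by (intro integrable_bounded_mult[OF _ vg iu]) measurable
  have "(LINT x|lborel. v x * u x) - (LINT x|lborel. (v x - g x) * u x) = (LINT x|lborel. g x * u x)"
    by (subst Bochner_Integration.integral_diff[OF ivu ivgu, symmetric]) (simp add: algebra_simps)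
  moreover have "(LINT x|lborel. (v x - g x) * u x) \<le> (LINT x|lborel. \<delta> * \<bar>u x\<bar>)"
  proof (rule integral_mono[OF ivgu])
    show "integrable lborel (\<lambda>x. \<delta> * \<bar>u x\<bar>)" using iu by simp
    fix x
    have "(v x - g x) * u x \<le> \<bar>v x - g x\<bar> * \<bar>u x\<bar>" by (metis abs_ge_self abs_mult)
    also have "\<dots> \<le> \<delta> * \<bar>u x\<bar>" by (intro mult_right_mono vg) auto
    finally show "(v x - g x) * u x \<le> \<delta> * \<bar>u x\<bar>" .
  qed
  ultimately show "(LINT x|lborel. corr \<Phi> \<rho> x * corr w \<rho> x) \<le> 0 + e"
    using gu \<delta>(2) unfolding v_def u_def by simp
qed

text \<open>The mollified energy is the double integral of \<open>\<rho> s * \<rho> t\<close>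
  against the integral of \<open>\<Phi> x * w (x + (t - s))\<close>. A positive energy
  \<open>J\<close> would keep the latter at least \<open>J / 2\<close> for small shifts, making the
  mollified energy positive.\<close>

lemma energy_nonpos: "(LINT x|lborel. \<Phi> x * w x) \<le> 0"
proof (rule ccontr)
  define J where "J = (LINT x|lborel. \<Phi> x * w x)"
  assume "\<not> (LINT x|lborel. \<Phi> x * w x) \<le> 0"
  then have J: "J > 0" by (simp add: J_def)
  have C0: "C \<ge> 0" using \<Phi>_bounded[of 0] by simp
  \<comment> \<open>A translation that moves \<open>w\<close> by less than \<open>e\<close> in L1
    changes the energy by at most \<open>C * e\<close>, thus by at most \<open>J / 2\<close>; the
    \<open>+ 1\<close> covers \<open>C = 0\<close>.\<close>
  define e where "e = J / (2 * (C + 1))"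
  have e: "e > 0" "C * e \<le> J / 2"
    unfolding e_def using J C0 by (auto simp: field_simps)
  obtain d where d: "d > 0" "\<And>a. norm a < d \<Longrightarrow> (LINT x|lborel. \<bar>w (x + a) - w x\<bar>) < e"
    using L1_continuousE[OF w_integrable e(1)] by blast
  \<comment> \<open>Half the radius, because both kernels contribute to the shift
    \<open>t - s\<close>.\<close>
  obtain \<rho> :: "'a \<Rightarrow> real" where \<rho>: "test_function \<rho>" "\<And>x. \<rho> x \<ge> 0" "\<And>x. d / 2 \<le> norm x \<Longrightarrow> \<rho> x = 0" "(LINT x|lborel. \<rho> x) > 0"
    using bump_exists[of "d / 2"] d(1) by auto
  note [measurable] = test_function_measurable[OF \<rho>(1)]
  note i\<rho> = test_function_integrable[OF \<rho>(1)]
  define v where "v = corr \<Phi> \<rho>"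
  have [measurable]: "v \<in> borel_measurable borel" unfolding v_def by (intro corr_measurable) measurable
  define V where "V = C * (LINT s|lborel. \<bar>\<rho> s\<bar>)"
  have V: "\<bar>v x\<bar> \<le> V" for x unfolding v_def V_def by (intro corr_bounded i\<rho> \<Phi>_bounded) measurable
  note iw = lborel_integrable_shift[OF w_integrable]
  have close: "J / 2 \<le> (LINT x|lborel. \<Phi> x * w (x + a))" if "norm a < d" for a
  proof -
    have 1: "integrable lborel (\<lambda>x. \<Phi> x * w x)" "integrable lborel (\<lambda>x. \<Phi> x * w (x + a))"
      by (intro integrable_bounded_mult[OF \<Phi>_measurable \<Phi>_bounded] iw w_integrable)+
    have "J - (LINT x|lborel. \<Phi> x * w (x + a)) = (LINT x|lborel. \<Phi> x * w x - \<Phi> x * w (x + a))"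
      unfolding J_def using 1 by simp
    also have "\<dots> \<le> (LINT x|lborel. C * \<bar>w (x + a) - w x\<bar>)"
    proof (rule integral_mono)
      show "integrable lborel (\<lambda>x. C * \<bar>w (x + a) - w x\<bar>)" using iw[of a] w_integrable by simp
      fix x
      have "\<Phi> x * w x - \<Phi> x * w (x + a) \<le> \<bar>\<Phi> x\<bar> * \<bar>w (x + a) - w x\<bar>"
        by (metis abs_ge_self abs_minus_commute abs_mult right_diff_distrib)
      also have "\<dots> \<le> C * \<bar>w (x + a) - w x\<bar>" by (intro mult_right_mono \<Phi>_bounded) auto
      finally show "\<Phi> x * w x - \<Phi> x * w (x + a) \<le> C * \<bar>w (x + a) - w x\<bar>" .
    qed (use 1 in simp)
    also have "\<dots> = C * (LINT x|lborel. \<bar>w (x + a) - w x\<bar>)" by simp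
    also have "\<dots> \<le> C * e" using d(2)[OF that] C0 by (intro mult_left_mono) auto
    finally show ?thesis using e(2) by simp
  qed
  have inner: "J / 2 * (LINT s|lborel. \<rho> s) \<le> corr w v t" if t: "norm t < d / 2" for t
  proof -
    have "corr w v t = (LINT x|lborel. w (x + t) * corr \<Phi> \<rho> x)"
      unfolding corr_def[of w] v_def by (simp add: add.commute)
    also have "\<dots> = (LINT s|lborel. \<rho> s * corr \<Phi> (\<lambda>x. w (x + t)) s)"
      by (rule corr_swap[OF \<Phi>_measurable \<Phi>_bounded iw i\<rho>])
    also have "J / 2 * (LINT s|lborel. \<rho> s) \<le> \<dots>"
    proof (rule integral_bump_ge[OF i\<rho> \<rho>(2,3)])
      have "integrable lborel (\<lambda>s. corr \<Phi> (\<lambda>x. w (x + t)) s * \<rho> s)"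
        by (intro integrable_bounded_mult[OF _ corr_bounded[OF \<Phi>_measurable \<Phi>_bounded iw] i\<rho>] corr_measurable) measurable
      then show "integrable lborel (\<lambda>s. \<rho> s * corr \<Phi> (\<lambda>x. w (x + t)) s)"
        by (simp add: mult.commute)
      fix s :: 'a assume s: "norm s < d / 2"
      have "corr \<Phi> (\<lambda>x. w (x + t)) s = (LINT y|lborel. \<Phi> y * w (y + (t - s)))"
        by (subst corr_shift_left) (auto simp: algebra_simps)
      moreover have "norm (t - s) < d" using norm_triangle_ineq4[of t s] s t by simp
      ultimately show "J / 2 \<le> corr \<Phi> (\<lambda>x. w (x + t)) s" using close by simp
    qed
    finally show ?thesis .
  qed
  have swap: "(LINT x|lborel. v x * corr w \<rho> x) = (LINT t|lborel. \<rho> t * corr w v t)"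
    by (rule corr_swap_integrable(2)[OF _ V w_integrable i\<rho>]) measurable
  have "J / 2 * (LINT s|lborel. \<rho> s) * (LINT s|lborel. \<rho> s) \<le> (LINT t|lborel. \<rho> t * corr w v t)"
  proof (rule integral_bump_ge[OF i\<rho> \<rho>(2,3) _ inner])
    have "\<bar>corr w v t\<bar> \<le> V * (LINT x|lborel. \<bar>w x\<bar>)" for t
    proof -
      \<comment> \<open>\<open>corr_bounded\<close> expects the bounded function first, so a
        translation exchanges the roles of \<open>w\<close> and \<open>v\<close>.\<close>
      have "corr w v t = corr v w (- t)"
        using lborel_integral_shift[of "\<lambda>y. w y * v (y - t)" t]
        unfolding corr_def by (simp add: add.commute mult.commute)
      then show ?thesis using corr_bounded[OF _ V w_integrable] by simp
    qed
    then have "integrable lborel (\<lambda>t. corr w v t * \<rho> t)"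
      by (intro integrable_bounded_mult i\<rho> corr_measurable) measurable
    then show "integrable lborel (\<lambda>t. \<rho> t * corr w v t)" by (simp add: mult.commute)
  qed
  moreover have "J / 2 * (LINT s|lborel. \<rho> s) * (LINT s|lborel. \<rho> s) > 0"
    using J \<rho>(4) by simp
  ultimately show False
    using mollified_energy_nonpos[OF \<rho>(1)] swap by (simp add: v_def)
qed

end

section \<open>Uniqueness\<close>

text \<open>Translation by \<open>a\<close> has translation by \<open>- a\<close> as its transpose,
  and a second difference contains both \<open>z\<close> and \<open>- z\<close>.\<close>

lemma second_diff_symmetric:
  fixes \<psi> \<eta> :: "'a::euclidean_space \<Rightarrow> real"
  assumes \<psi>: "test_function \<psi>" and \<eta>: "test_function \<eta>"
  shows "(LINT x|lborel. \<psi> x * second_diff z \<eta> x) = (LINT x|lborel. \<eta> x * second_diff z \<psi> x)"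
proof -
  note [measurable] = test_function_measurable[OF \<psi>] test_function_measurable[OF \<eta>]
  have int: "integrable lborel (\<lambda>x. f x * g (x + a))"
    if f: "test_function f" and g: "test_function g" for f g :: "'a \<Rightarrow> real" and a
  proof -
    obtain M where "\<And>x. \<bar>f x\<bar> \<le> M" using test_function_bounded[OF f] by blast
    then show ?thesis
      by (intro integrable_bounded_mult test_function_measurable f
          test_function_integrable[OF test_function_shift[OF g]])
  qed
  have expand: "(LINT x|lborel. f x * second_diff z g x) =
      (LINT x|lborel. f x * g (x + z)) + (LINT x|lborel. f x * g (x + (- z))) - 2 * (LINT x|lborel. f x * g (x + 0))"
    if f: "test_function f" and g: "test_function g" for f g :: "'a \<Rightarrow> real"
  proof -
    have "(LINT x|lborel. f x * second_diff z g x) =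
        (LINT x|lborel. f x * g (x + z) + f x * g (x + (- z)) - 2 * (f x * g (x + 0)))"
      by (intro Bochner_Integration.integral_cong) (auto simp: second_diff_def algebra_simps)
    then show ?thesis
      using int[OF f g, of z] int[OF f g, of "- z"] int[OF f g, of 0] by simp
  qed
  have "(LINT x|lborel. \<psi> x * \<eta> (x + a)) = (LINT x|lborel. \<eta> x * \<psi> (x + (- a)))" for a
    using lborel_integral_shift[of "\<lambda>x. \<eta> x * \<psi> (x + (- a))" a] by (simp add: mult.commute)
  from this[of z] this[of "- z"] this[of 0] show ?thesis
    unfolding expand[OF \<psi> \<eta>] expand[OF \<eta> \<psi>] by simp
qed

lemma levy_op_symmetric:
  fixes \<mu> :: "'a::euclidean_space measure"
  assumes \<mu>: "levy_measure \<mu>" and \<psi>: "test_function \<psi>" and \<eta>: "test_function \<eta>"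
  shows "(LINT x|lborel. \<psi> x * levy_op P \<sigma> \<mu> \<eta> x) = (LINT x|lborel. \<eta> x * levy_op P \<sigma> \<mu> \<psi> x)"
proof -
  obtain A where A: "\<And>x. \<bar>\<psi> x\<bar> \<le> A" using test_function_bounded[OF \<psi>] by blast
  obtain B where B: "\<And>x. \<bar>\<eta> x\<bar> \<le> B" using test_function_bounded[OF \<eta>] by blast
  note m = test_function_measurable[OF \<psi>] test_function_measurable[OF \<eta>]
  show ?thesis
    by (intro antisym levy_op_compare[OF \<mu> \<eta> \<psi> m(1) A m(2) B] levy_op_compare[OF \<mu> \<psi> \<eta> m(2) B m(1) A])
      (simp_all add: second_diff_symmetric[OF \<psi> \<eta>])
qed

text \<open>For small \<open>t\<close> the linear term dominates; the choice
  \<open>t = X / (\<bar>Y\<bar> + 1)\<close> turns the expression into a positive multiple of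
  \<open>t\<^sup>2\<close> unless \<open>X = 0\<close>.\<close>

lemma quadratic_nonpos_imp_zero:
  fixes X Y :: real
  assumes "\<And>t. 2 * t * X + t\<^sup>2 * Y \<le> 0"
  shows "X = 0"
proof (rule ccontr)
  assume "X \<noteq> 0"
  define t where "t = X / (\<bar>Y\<bar> + 1)"
  have t: "t * (\<bar>Y\<bar> + 1) = X" unfolding t_def by (simp add: field_simps)
  have "t \<noteq> 0" using \<open>X \<noteq> 0\<close> t by auto
  have "2 * t * X + t\<^sup>2 * Y = t\<^sup>2 * (2 * \<bar>Y\<bar> + 2 + Y)"
    unfolding t[symmetric] by (simp add: power2_eq_square algebra_simps)
  moreover have "\<dots> > 0" using \<open>t \<noteq> 0\<close> by (intro mult_pos_pos) (auto simp: abs_if)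
  ultimately show False using assms[of t] by simp
qed

lemma (in weak_equation) eq_0_if_energy_nonneg:
  assumes nonneg: "\<And>x. \<Phi> x * w x \<ge> 0"
  shows "AE x in lborel. w x = 0"
proof (rule test_function_separating[OF w_integrable])
  fix \<psi> :: "'a \<Rightarrow> real" assume \<psi>: "test_function \<psi>"
  define L where "L = levy_op P \<sigma> \<mu> \<psi>"
  have iL: "integrable lborel L" unfolding L_def by (rule levy_op_integrable[OF levy \<psi>])
  note i\<psi> = test_function_integrable[OF \<psi>]
  note m = test_function_measurable[OF \<psi>]
  note [measurable] = m
  obtain A where A: "\<And>x. \<bar>\<psi> x\<bar> \<le> A" using test_function_bounded[OF \<psi>] by blast
  have "2 * t * (LINT x|lborel. w x * \<psi> x) + t\<^sup>2 * (LINT x|lborel. \<psi> x * L x) \<le> 0" for t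
  proof -
    \<comment> \<open>The perturbation stays in the locale: \<open>\<psi>\<close> is bounded and
      integrable, \<open>L\<close> is integrable, and symmetry of the operator gives the weak
      equation for the added terms.\<close>
    interpret pert: weak_equation P \<sigma> \<mu> "\<lambda>x. \<Phi> x + t * \<psi> x" "\<lambda>x. w x + t * L x" "C + \<bar>t\<bar> * A"
    proof
      show "\<bar>\<Phi> x + t * \<psi> x\<bar> \<le> C + \<bar>t\<bar> * A" for x
      proof -
        have "\<bar>\<Phi> x + t * \<psi> x\<bar> \<le> \<bar>\<Phi> x\<bar> + \<bar>t\<bar> * \<bar>\<psi> x\<bar>"
          using abs_triangle_ineq[of "\<Phi> x" "t * \<psi> x"] by (simp add: abs_mult)
        also have "\<dots> \<le> C + \<bar>t\<bar> * A"
          by (intro add_mono \<Phi>_bounded mult_left_mono A) auto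
        finally show ?thesis .
      qed
      show "\<exists>b. integrable lborel b \<and> (\<forall>x. \<bar>\<Phi> x + t * \<psi> x\<bar> \<le> \<delta> + b x)" if "\<delta> > 0" for \<delta>
      proof -
        obtain b where b: "integrable lborel b" "\<And>x. \<bar>\<Phi> x\<bar> \<le> \<delta> + b x"
          using \<Phi>_decay[OF \<open>\<delta> > 0\<close>] by blast
        have "\<bar>\<Phi> x + t * \<psi> x\<bar> \<le> \<delta> + (b x + \<bar>t * \<psi> x\<bar>)" for x
          using b(2)[of x] by linarith
        with b(1) i\<psi> show ?thesis
          by (intro exI[of _ "\<lambda>x. b x + \<bar>t * \<psi> x\<bar>"]) auto
      qed
      show "integrable lborel (\<lambda>x. w x + t * L x)" using w_integrable iL by simp
      fix \<eta> :: "'a \<Rightarrow> real" assume \<eta>: "test_function \<eta>"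
      obtain B where B: "\<And>x. \<bar>\<eta> x\<bar> \<le> B" using test_function_bounded[OF \<eta>] by blast
      have "integrable lborel (\<lambda>x. \<eta> x * w x)" "integrable lborel (\<lambda>x. \<eta> x * L x)"
        by (intro integrable_bounded_mult[OF test_function_measurable[OF \<eta>] B] w_integrable iL)+
      then have 1: "(LINT x|lborel. (w x + t * L x) * \<eta> x) = (LINT x|lborel. w x * \<eta> x) + t * (LINT x|lborel. \<eta> x * L x)"
        by (subst integral_mult_right_zero[symmetric], subst Bochner_Integration.integral_add[symmetric])
          (auto simp: algebra_simps)
      have "integrable lborel (\<lambda>x. \<Phi> x * levy_op P \<sigma> \<mu> \<eta> x)" "integrable lborel (\<lambda>x. \<psi> x * levy_op P \<sigma> \<mu> \<eta> x)"
        by (intro levy_op_integral(1)[OF levy \<eta> _ \<Phi>_bounded] levy_op_integral(1)[OF levy \<eta> _ A]; measurable)+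
      then have 2: "(LINT x|lborel. (\<Phi> x + t * \<psi> x) * levy_op P \<sigma> \<mu> \<eta> x)
          = (LINT x|lborel. \<Phi> x * levy_op P \<sigma> \<mu> \<eta> x) + t * (LINT x|lborel. \<psi> x * levy_op P \<sigma> \<mu> \<eta> x)"
        by (subst integral_mult_right_zero[symmetric], subst Bochner_Integration.integral_add[symmetric])
          (auto simp: algebra_simps)
      show "(LINT x|lborel. (w x + t * L x) * \<eta> x) = (LINT x|lborel. (\<Phi> x + t * \<psi> x) * levy_op P \<sigma> \<mu> \<eta> x)"
        unfolding 1 2 weak[OF \<eta>] unfolding L_def levy_op_symmetric[OF levy \<eta> \<psi>] ..
    qed (use levy in measurable)
    have i: "integrable lborel (\<lambda>x. \<Phi> x * w x)" "integrable lborel (\<lambda>x. \<psi> x * w x)"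
        "integrable lborel (\<lambda>x. \<Phi> x * L x)" "integrable lborel (\<lambda>x. \<psi> x * L x)"
      by (intro integrable_bounded_mult[OF _ \<Phi>_bounded] integrable_bounded_mult[OF _ A] w_integrable iL; measurable)+
    have "(LINT x|lborel. (\<Phi> x + t * \<psi> x) * (w x + t * L x))
        = (LINT x|lborel. \<Phi> x * w x + t * (\<psi> x * w x) + t * (\<Phi> x * L x) + t\<^sup>2 * (\<psi> x * L x))"
      by (simp add: algebra_simps power2_eq_square)
    also have "\<dots> = (LINT x|lborel. \<Phi> x * w x) + t * (LINT x|lborel. \<psi> x * w x)
        + t * (LINT x|lborel. \<Phi> x * L x) + t\<^sup>2 * (LINT x|lborel. \<psi> x * L x)"
      using i by simp
    also have "(LINT x|lborel. \<Phi> x * L x) = (LINT x|lborel. w x * \<psi> x)"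
      using weak[OF \<psi>] by (simp add: L_def)
    finally have "(LINT x|lborel. \<Phi> x * w x) + t * (LINT x|lborel. \<psi> x * w x)
        + t * (LINT x|lborel. w x * \<psi> x) + t\<^sup>2 * (LINT x|lborel. \<psi> x * L x) \<le> 0"
      using pert.energy_nonpos by simp
    moreover have "(LINT x|lborel. \<Phi> x * w x) \<ge> 0"
      using nonneg by (intro integral_nonneg_AE) auto
    ultimately show ?thesis by (simp add: mult.commute[of "\<psi> _"])
  qed
  then show "(LINT x|lborel. w x * \<psi> x) = 0" by (rule quadratic_nonpos_imp_zero)
qed

text \<open>Truncation at the essential bound trades almost-everywhere bounds for the pointwise ones
  used in the estimates above; \<open>\<bar>C\<bar>\<close> ensures that the truncation interval is
  nonempty.\<close>

lemma Linfty_bounded_version: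
  assumes "Linfty w"
  obtains w' C where "w' \<in> borel_measurable borel" "\<And>x. \<bar>w' x\<bar> \<le> C" "AE x in lborel. w x = w' x"
proof -
  obtain C where w: "w \<in> borel_measurable borel" "AE x in lborel. \<bar>w x\<bar> \<le> C"
    using assms unfolding Linfty_def by auto
  show thesis
  proof
    show "(\<lambda>x. max (- \<bar>C\<bar>) (min \<bar>C\<bar> (w x))) \<in> borel_measurable borel" using w(1) by measurable
    show "\<bar>max (- \<bar>C\<bar>) (min \<bar>C\<bar> (w x))\<bar> \<le> \<bar>C\<bar>" for x by (auto simp: max_def min_def)
    show "AE x in lborel. w x = max (- \<bar>C\<bar>) (min \<bar>C\<bar> (w x))"
      using w(2) by eventually_elim (auto simp: max_def min_def)
  qed
qed

text \<open>The definition integrates a difference, and a Bochner integral splits only over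
  integrable parts. Pointwise bounds on \<open>w'\<close>, and through monotonicity on
  \<open>\<phi> (w' x)\<close>, make both parts integrable.\<close>

lemma distributional_solution_bounded:
  fixes \<mu> :: "'a::euclidean_space measure"
  assumes \<mu>: "levy_measure \<mu>" and \<phi>: "mono \<phi>" "continuous_on UNIV \<phi>"
    and sol: "distributional_solution P \<sigma> \<mu> \<phi> f w"
    and w': "w' \<in> borel_measurable borel" "\<And>x. \<bar>w' x\<bar> \<le> C" "AE x in lborel. w x = w' x"
    and \<eta>: "test_function \<eta>"
  shows "integrable lborel (\<lambda>x. w' x * \<eta> x)"
    and "integrable lborel (\<lambda>x. \<phi> (w' x) * levy_op P \<sigma> \<mu> \<eta> x)"
    and "(LINT x|lborel. w' x * \<eta> x) - (LINT x|lborel. \<phi> (w' x) * levy_op P \<sigma> \<mu> \<eta> x) = (LINT x|lborel. f x * \<eta> x)"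
proof -
  note [measurable] = w'(1) borel_measurable_continuous_onI[OF \<phi>(2)]
  have "\<bar>\<phi> (w' x)\<bar> \<le> max \<bar>\<phi> C\<bar> \<bar>\<phi> (- C)\<bar>" for x
    using w'(2)[of x] monoD[OF \<phi>(1), of "w' x" C] monoD[OF \<phi>(1), of "- C" "w' x"] by (simp add: abs_le_iff) linarith
  then show i2: "integrable lborel (\<lambda>x. \<phi> (w' x) * levy_op P \<sigma> \<mu> \<eta> x)"
    by (intro levy_op_integral(1)[OF \<mu> \<eta>]) measurable
  show i1: "integrable lborel (\<lambda>x. w' x * \<eta> x)"
    by (intro integrable_bounded_mult[OF w'(1,2)] test_function_integrable[OF \<eta>])
  have [measurable]: "w \<in> borel_measurable borel"
    using sol by (simp add: distributional_solution_def Linfty_def)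
  have [measurable]: "levy_op P \<sigma> \<mu> \<eta> \<in> borel_measurable borel" "\<eta> \<in> borel_measurable borel"
    using levy_op_integrable[OF \<mu> \<eta>] test_function_measurable[OF \<eta>] by (auto dest: borel_measurable_integrable)
  have "(LINT x|lborel. f x * \<eta> x) = (LINT x|lborel. w x * \<eta> x - \<phi> (w x) * levy_op P \<sigma> \<mu> \<eta> x)"
    using sol \<eta> by (simp add: distributional_solution_def)
  also have "\<dots> = (LINT x|lborel. w' x * \<eta> x - \<phi> (w' x) * levy_op P \<sigma> \<mu> \<eta> x)"
    using w'(3) by (intro integral_cong_AE) (auto elim!: eventually_mono)
  also have "\<dots> = (LINT x|lborel. w' x * \<eta> x) - (LINT x|lborel. \<phi> (w' x) * levy_op P \<sigma> \<mu> \<eta> x)"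
    by (rule Bochner_Integration.integral_diff[OF i1 i2])
  finally show "(LINT x|lborel. w' x * \<eta> x) - (LINT x|lborel. \<phi> (w' x) * levy_op P \<sigma> \<mu> \<eta> x) = (LINT x|lborel. f x * \<eta> x)" ..
qed

text \<open>A substitute for a Lipschitz bound. Points closer than the uniform continuity radius
  \<open>e\<close> cost at most \<open>\<delta>\<close>; others cost at most \<open>2 * M\<close>,
  which is at most \<open>2 * M / e * \<bar>s - t\<bar>\<close>.\<close>

lemma continuous_difference_bound:
  fixes \<phi> :: "real \<Rightarrow> real"
  assumes "continuous_on UNIV \<phi>" "\<delta> > 0"
  obtains K where "\<And>s t. \<bar>s\<bar> \<le> C \<Longrightarrow> \<bar>t\<bar> \<le> C \<Longrightarrow> \<bar>\<phi> s - \<phi> t\<bar> \<le> \<delta> + K * \<bar>s - t\<bar>"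
proof -
  have cont: "continuous_on {-C..C} \<phi>" using assms(1) continuous_on_subset by blast
  have "uniformly_continuous_on {-C..C} \<phi>"
    by (intro compact_uniformly_continuous cont) simp
  then obtain e where e: "e > 0" "\<And>s t. s \<in> {-C..C} \<Longrightarrow> t \<in> {-C..C} \<Longrightarrow> dist t s < e \<Longrightarrow> dist (\<phi> t) (\<phi> s) < \<delta>"
    using assms(2) unfolding uniformly_continuous_on_def by metis
  have "bounded (\<phi> ` {-C..C})"
    by (intro compact_imp_bounded compact_continuous_image cont) simp
  then obtain M where M: "M > 0" "\<And>s. s \<in> {-C..C} \<Longrightarrow> \<bar>\<phi> s\<bar> \<le> M"
    unfolding bounded_pos by auto
  have "\<bar>\<phi> s - \<phi> t\<bar> \<le> \<delta> + 2 * M / e * \<bar>s - t\<bar>" if "\<bar>s\<bar> \<le> C" "\<bar>t\<bar> \<le> C" for s t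
  proof (cases "\<bar>s - t\<bar> < e")
    case True
    then have "\<bar>\<phi> s - \<phi> t\<bar> < \<delta>" using e(2)[of t s] that by (simp add: dist_real_def abs_le_iff)
    moreover have "0 \<le> 2 * M / e * \<bar>s - t\<bar>" using M(1) e(1) by simp
    ultimately show ?thesis by simp
  next
    case False
    have "\<bar>\<phi> s - \<phi> t\<bar> \<le> 2 * M" using M(2)[of s] M(2)[of t] that by (simp add: abs_le_iff)
    also have "\<dots> \<le> 2 * M / e * \<bar>s - t\<bar>" using False M(1) e(1) by (simp add: field_simps)
    finally show ?thesis using assms(2) by simp
  qed
  then show thesis by (rule that)
qed

theorem theorem3:
  fixes P :: nat and \<sigma> :: "nat \<Rightarrow> 'a::euclidean_space" and \<mu> :: "'a measure"
    and \<phi> :: "real \<Rightarrow> real" and f w1 w2 :: "'a \<Rightarrow> real"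
  assumes "levy_measure \<mu>"
    and "mono \<phi>" and "continuous_on UNIV \<phi>"
    and "Linfty f"
    and "distributional_solution P \<sigma> \<mu> \<phi> f w1" and "integrable lborel (\<lambda>x. w1 x - f x)"
    and "distributional_solution P \<sigma> \<mu> \<phi> f w2" and "integrable lborel (\<lambda>x. w2 x - f x)"
  shows "AE x in lborel. w1 x = w2 x"
proof -
  have "Linfty w1" "Linfty w2" using assms(5,7) by (simp_all add: distributional_solution_def)
  obtain v1 C1 where v1: "v1 \<in> borel_measurable borel" "\<And>x. \<bar>v1 x\<bar> \<le> C1" "AE x in lborel. w1 x = v1 x"
    using Linfty_bounded_version[OF \<open>Linfty w1\<close>] by blast
  obtain v2 C2 where v2: "v2 \<in> borel_measurable borel" "\<And>x. \<bar>v2 x\<bar> \<le> C2" "AE x in lborel. w2 x = v2 x"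
    using Linfty_bounded_version[OF \<open>Linfty w2\<close>] by blast
  note [measurable] = v1(1) v2(1) borel_measurable_continuous_onI[OF assms(3)]
  have mw: "w1 \<in> borel_measurable borel" "w2 \<in> borel_measurable borel"
    using \<open>Linfty w1\<close> \<open>Linfty w2\<close> by (simp_all add: Linfty_def)
  define C where "C = max C1 C2"
  have C: "\<bar>v1 x\<bar> \<le> C" "\<bar>v2 x\<bar> \<le> C" for x
    using v1(2)[of x] v2(2)[of x] by (auto simp: C_def)
  have "integrable lborel (\<lambda>x. w1 x - w2 x)"
    using Bochner_Integration.integrable_diff[OF assms(6,8)] by simp
  moreover have "AE x in lborel. w1 x - w2 x = v1 x - v2 x"
    using v1(3) v2(3) by eventually_elim simp
  ultimately have int: "integrable lborel (\<lambda>x. v1 x - v2 x)"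
    using mw by (subst integrable_cong_AE[of _ _ "\<lambda>x. w1 x - w2 x"]) (auto elim!: eventually_mono)
  have \<phi>C: "\<bar>\<phi> s\<bar> \<le> max \<bar>\<phi> C\<bar> \<bar>\<phi> (- C)\<bar>" if "\<bar>s\<bar> \<le> C" for s
    using that monoD[OF assms(2), of s C] monoD[OF assms(2), of "- C" s] by (simp add: abs_le_iff) linarith
  \<comment> \<open>The bounded representatives replace the solutions from here on, and subtracting
    their equations removes \<open>f\<close>.\<close>
  interpret weak_equation P \<sigma> \<mu> "\<lambda>x. \<phi> (v1 x) - \<phi> (v2 x)" "\<lambda>x. v1 x - v2 x" "2 * max \<bar>\<phi> C\<bar> \<bar>\<phi> (- C)\<bar>"
  proof
    show "\<bar>\<phi> (v1 x) - \<phi> (v2 x)\<bar> \<le> 2 * max \<bar>\<phi> C\<bar> \<bar>\<phi> (- C)\<bar>" for x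
      using \<phi>C[OF C(1)[of x]] \<phi>C[OF C(2)[of x]] by linarith
    show "\<exists>b. integrable lborel b \<and> (\<forall>x. \<bar>\<phi> (v1 x) - \<phi> (v2 x)\<bar> \<le> \<delta> + b x)" if "\<delta> > 0" for \<delta>
    proof -
      obtain K where K: "\<And>s t. \<bar>s\<bar> \<le> C \<Longrightarrow> \<bar>t\<bar> \<le> C \<Longrightarrow> \<bar>\<phi> s - \<phi> t\<bar> \<le> \<delta> + K * \<bar>s - t\<bar>"
        using continuous_difference_bound[OF assms(3) \<open>\<delta> > 0\<close>] by blast
      show ?thesis
        by (rule exI[of _ "\<lambda>x. K * \<bar>v1 x - v2 x\<bar>"]) (use int K C in auto)
    qed
    fix \<eta> :: "'a \<Rightarrow> real" assume \<eta>: "test_function \<eta>"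
    note s1 = distributional_solution_bounded[OF assms(1-3,5) v1 \<eta>]
    note s2 = distributional_solution_bounded[OF assms(1-3,7) v2 \<eta>]
    have "(LINT x|lborel. (v1 x - v2 x) * \<eta> x) = (LINT x|lborel. v1 x * \<eta> x) - (LINT x|lborel. v2 x * \<eta> x)"
      using s1(1) s2(1) by (simp add: left_diff_distrib)
    also have "\<dots> = (LINT x|lborel. \<phi> (v1 x) * levy_op P \<sigma> \<mu> \<eta> x) - (LINT x|lborel. \<phi> (v2 x) * levy_op P \<sigma> \<mu> \<eta> x)"
      using s1(3) s2(3) by simp
    also have "\<dots> = (LINT x|lborel. (\<phi> (v1 x) - \<phi> (v2 x)) * levy_op P \<sigma> \<mu> \<eta> x)"
      using s1(2) s2(2) by (simp add: left_diff_distrib)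
    finally show "(LINT x|lborel. (v1 x - v2 x) * \<eta> x) = (LINT x|lborel. (\<phi> (v1 x) - \<phi> (v2 x)) * levy_op P \<sigma> \<mu> \<eta> x)" .
  qed (use assms(1) int in measurable)
  \<comment> \<open>Monotonicity of \<open>\<phi>\<close> supplies the sign that the locale does not
    record.\<close>
  have "(\<phi> (v1 x) - \<phi> (v2 x)) * (v1 x - v2 x) \<ge> 0" for x
    using monoD[OF assms(2), of "v1 x" "v2 x"] monoD[OF assms(2), of "v2 x" "v1 x"]
    by (cases "v1 x \<le> v2 x") (auto simp: mult_nonneg_nonneg mult_nonpos_nonpos)
  then have "AE x in lborel. v1 x - v2 x = 0"
    by (rule eq_0_if_energy_nonneg)
  with v1(3) v2(3) show ?thesis by eventually_elim simp
qed

end
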